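(* Every HRLQ instance that admits a feasible matching admits a feasible relaxed stable matching. Moreover, there is a polynomial-time algorithm that, given such an instance, outputs a feasible relaxed stable matching whose size is at least $\frac{2}{3}$ of the maximum size of a feasible relaxed stable matching of the instance.
   Context: An HRLQ instance is a bipartite graph $G=(\mathcal{R}\cup\mathcal{H},E)$ with residents $\mathcal{R}$ and hospitals $\mathcal{H}$; $(r,h)\in E$ means mutual acceptability. Each hospital $h$ has an upper quota $q^+(h)$ and a lower quota $q^-(h)\le q^+(h)$. Every vertex ranks its neighbours strictly; $b_1>_a b_2$ means $a$ prefers $b_1$. A matching $M\subseteq E$ assigns each resident at most one hospital and each hospital $h$ at most $q^+(h)$ residents; $M(r)$ is $r$'s hospital ($\bot$ if unmatched, worst for $r$), $M(h)$ the residents of $h$; $h$ is under-subscribed if $|M(h)|<q^+(h)$. $M$ is feasible if $|M(h)|\ge q^-(h)$ for all $h$. A pair $(r,h)\in E\setminus M$ is a blocking pair if $h>_r M(r)$ and either $h$ is under-subscribed or some $r'\in M(h)$ satisfies $r>_h r'$. $M$ is relaxed stable if for every hospital $h$ at most $q^-(h)$ residents of $M(h)$ participate in blocking pairs, and no unmatched resident participates in a blocking pair. *)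

theory Defs
  imports Complex_Main "HOL-Computational_Algebra.Polynomial"
begin

section \<open>HRLQ instances and relaxed stability\<close>

text \<open>The strict ranking of a vertex is given by its preference list, most preferred neighbour first.\<close>

record ('r, 'h) hrlq =
  residents :: "'r set"
  hospitals :: "'h set"
  edges :: "('r \<times> 'h) set"
  rpref :: "'r \<Rightarrow> 'h list"
  hpref :: "'h \<Rightarrow> 'r list"
  lquota :: "'h \<Rightarrow> nat"
  uquota :: "'h \<Rightarrow> nat"

definition hrlq_instance :: "('r, 'h) hrlq \<Rightarrow> bool" where
  "hrlq_instance I \<longleftrightarrow>
     finite (residents I) \<and> finite (hospitals I) \<and>
     edges I \<subseteq> residents I \<times> hospitals I \<and>
     (\<forall>r\<in>residents I. distinct (rpref I r) \<and> set (rpref I r) = {h. (r, h) \<in> edges I}) \<and>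
     (\<forall>h\<in>hospitals I. distinct (hpref I h) \<and> set (hpref I h) = {r. (r, h) \<in> edges I}) \<and>
     (\<forall>h\<in>hospitals I. lquota I h \<le> uquota I h)"

definition precedes :: "'a list \<Rightarrow> 'a \<Rightarrow> 'a \<Rightarrow> bool" where
  "precedes xs a b \<longleftrightarrow> (\<exists>i j. i < j \<and> j < length xs \<and> xs ! i = a \<and> xs ! j = b)"

definition hospital_of :: "('r \<times> 'h) set \<Rightarrow> 'r \<Rightarrow> 'h option" where
  "hospital_of M r = (if \<exists>h. (r, h) \<in> M then Some (THE h. (r, h) \<in> M) else None)"

definition residents_of :: "('r \<times> 'h) set \<Rightarrow> 'h \<Rightarrow> 'r set" where
  "residents_of M h = {r. (r, h) \<in> M}"

definition matching :: "('r, 'h) hrlq \<Rightarrow> ('r \<times> 'h) set \<Rightarrow> bool" where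
  "matching I M \<longleftrightarrow>
     M \<subseteq> edges I \<and>
     (\<forall>r\<in>residents I. card {h. (r, h) \<in> M} \<le> 1) \<and>
     (\<forall>h\<in>hospitals I. card (residents_of M h) \<le> uquota I h)"

definition feasible_matching :: "('r, 'h) hrlq \<Rightarrow> ('r \<times> 'h) set \<Rightarrow> bool" where
  "feasible_matching I M \<longleftrightarrow>
     matching I M \<and> (\<forall>h\<in>hospitals I. lquota I h \<le> card (residents_of M h))"

definition under_subscribed :: "('r, 'h) hrlq \<Rightarrow> ('r \<times> 'h) set \<Rightarrow> 'h \<Rightarrow> bool" where
  "under_subscribed I M h \<longleftrightarrow> card (residents_of M h) < uquota I h"

definition resident_prefers :: "('r, 'h) hrlq \<Rightarrow> 'r \<Rightarrow> 'h \<Rightarrow> 'h option \<Rightarrow> bool" where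
  "resident_prefers I r h a =
     (case a of None \<Rightarrow> True | Some h' \<Rightarrow> precedes (rpref I r) h h')"

definition blocking_pair :: "('r, 'h) hrlq \<Rightarrow> ('r \<times> 'h) set \<Rightarrow> 'r \<Rightarrow> 'h \<Rightarrow> bool" where
  "blocking_pair I M r h \<longleftrightarrow>
     (r, h) \<in> edges I - M \<and>
     resident_prefers I r h (hospital_of M r) \<and>
     (under_subscribed I M h \<or> (\<exists>r'\<in>residents_of M h. precedes (hpref I h) r r'))"

definition relaxed_stable :: "('r, 'h) hrlq \<Rightarrow> ('r \<times> 'h) set \<Rightarrow> bool" where
  "relaxed_stable I M \<longleftrightarrow>
     (\<forall>h\<in>hospitals I.
        card {r \<in> residents_of M h. \<exists>h'. blocking_pair I M r h'} \<le> lquota I h) \<and>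
     (\<forall>r\<in>residents I. hospital_of M r = None \<longrightarrow> \<not> (\<exists>h. blocking_pair I M r h))"

definition max_feasible_relaxed_stable_size :: "('r, 'h) hrlq \<Rightarrow> nat" where
  "max_feasible_relaxed_stable_size I =
     Max (card ` {M. feasible_matching I M \<and> relaxed_stable I M})"


section \<open>Random-access programs with running time\<close>

text \<open>
  The machine model is the unit-cost RAM in structured form: the memory consists of named,
  unbounded arrays of natural numbers. Arithmetic is restricted to addition and truncated
  subtraction. Without multiplication, the bit length of the stored numbers grows by at most a
  constant (depending on the program) per step, and so unit-cost polynomial time coincides with
  polynomial time on Turing machines. The expressions of a fixed program have bounded size;
  hence evaluating one is charged together with the command in which it occurs.
\<close>

type_synonym memory = "string \<Rightarrow> nat \<Rightarrow> nat"

datatype aexp = Const nat | Read string aexp | Plus aexp aexp | Minus aexp aexp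

datatype bexp = Less aexp aexp | Equal aexp aexp | Neg bexp | Conj bexp bexp

datatype com =
    Skip
  | Store string aexp aexp
  | Seq com com
  | Cond bexp com com
  | While bexp com

fun aval :: "aexp \<Rightarrow> memory \<Rightarrow> nat" where
  "aval (Const n) s = n"
| "aval (Read x a) s = s x (aval a s)"
| "aval (Plus a b) s = aval a s + aval b s"
| "aval (Minus a b) s = aval a s - aval b s"

fun bval :: "bexp \<Rightarrow> memory \<Rightarrow> bool" where
  "bval (Less a b) s \<longleftrightarrow> aval a s < aval b s"
| "bval (Equal a b) s \<longleftrightarrow> aval a s = aval b s"
| "bval (Neg b) s \<longleftrightarrow> \<not> bval b s"
| "bval (Conj b c) s \<longleftrightarrow> bval b s \<and> bval c s"

text \<open>\<open>runs c s t s'\<close>: started in memory \<open>s\<close>, program \<open>c\<close> halts after \<open>t\<close> steps in memory \<open>s'\<close>.\<close>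

inductive runs :: "com \<Rightarrow> memory \<Rightarrow> nat \<Rightarrow> memory \<Rightarrow> bool" where
  Skip: "runs Skip s 1 s"
| Store: "runs (Store x a b) s 1 (s(x := (s x)(aval a s := aval b s)))"
| Seq: "runs c1 s1 t1 s2 \<Longrightarrow> runs c2 s2 t2 s3 \<Longrightarrow> runs (Seq c1 c2) s1 (t1 + t2) s3"
| CondTrue: "bval b s \<Longrightarrow> runs c1 s t s' \<Longrightarrow> runs (Cond b c1 c2) s (1 + t) s'"
| CondFalse: "\<not> bval b s \<Longrightarrow> runs c2 s t s' \<Longrightarrow> runs (Cond b c1 c2) s (1 + t) s'"
| WhileFalse: "\<not> bval b s \<Longrightarrow> runs (While b c) s 1 s"
| WhileTrue: "bval b s1 \<Longrightarrow> runs c s1 t1 s2 \<Longrightarrow> runs (While b c) s2 t2 s3 \<Longrightarrow>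
    runs (While b c) s1 (1 + t1 + t2) s3"

inductive_cases SkipE: "runs Skip s t s'"
inductive_cases StoreE: "runs (Store x a b) s t s'"
inductive_cases SeqE: "runs (Seq c1 c2) s t s'"

lemma runs_deterministic: "runs c s t s' \<Longrightarrow> runs c s u s'' \<Longrightarrow> u = t \<and> s'' = s'"
proof (induction arbitrary: u s'' rule: runs.induct)
  case (Skip s)
  then show ?case by (rule SkipE) simp
next
  case (Store x a b s)
  then show ?case by (rule StoreE) simp
next
  case (Seq c1 s1 t1 s2 c2 t2 s3)
  from Seq.prems obtain v w m where u: "u = v + w" and 1: "runs c1 s1 v m" and 2: "runs c2 m w s''"
    by (rule SeqE)
  from Seq.IH(1)[OF 1] have "v = t1" "m = s2" by simp_all
  with Seq.IH(2) 2 u show ?case by simp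
next
  case (CondTrue b s c1 t s' c2)
  from CondTrue.prems CondTrue.hyps(1) obtain v where "u = 1 + v" and "runs c1 s v s''"
    by (cases rule: runs.cases) simp_all
  with CondTrue.IH show ?case by simp
next
  case (CondFalse b s c2 t s' c1)
  from CondFalse.prems CondFalse.hyps(1) obtain v where "u = 1 + v" and "runs c2 s v s''"
    by (cases rule: runs.cases) simp_all
  with CondFalse.IH show ?case by simp
next
  case (WhileFalse b s c)
  from WhileFalse.prems WhileFalse.hyps show ?case
    by (cases rule: runs.cases) simp_all
next
  case (WhileTrue b s1 c t1 s2 t2 s3)
  from WhileTrue.prems WhileTrue.hyps(1) obtain v w m
    where u: "u = 1 + v + w" and 1: "runs c s1 v m" and 2: "runs (While b c) m w s''"
    by (cases rule: runs.cases) simp_all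
  from WhileTrue.IH(1)[OF 1] have "v = t1" "m = s2" by simp_all
  with WhileTrue.IH(2) 2 u show ?case by simp
qed


section \<open>Instances as input and matchings as output\<close>

definition numbered_instance :: "(nat, nat) hrlq \<Rightarrow> bool" where
  "numbered_instance I \<longleftrightarrow>
     hrlq_instance I \<and>
     residents I = {..<card (residents I)} \<and> hospitals I = {..<card (hospitals I)}"

text \<open>
  Up to a constant factor this is the number of memory cells occupied by the input; the bit length
  of the quotas is not counted, so a bound in this size is at least as strong as one in the bit
  length of the input.
\<close>

definition instance_size :: "('r, 'h) hrlq \<Rightarrow> nat" where
  "instance_size I = card (residents I) + card (hospitals I) + card (edges I)"

definition array_of_list :: "nat list \<Rightarrow> nat \<Rightarrow> nat" where
  "array_of_list xs i = (if i < length xs then xs ! i else 0)"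

text \<open>The preference lists are stored consecutively, with their lengths in a separate array.\<close>

definition input_memory :: "(nat, nat) hrlq \<Rightarrow> memory" where
  "input_memory I =
     (let rs = [0..<card (residents I)]; hs = [0..<card (hospitals I)] in
      (\<lambda>_ _. 0)
        (''count'' := array_of_list [length rs, length hs],
         ''lquota'' := array_of_list (map (lquota I) hs),
         ''uquota'' := array_of_list (map (uquota I) hs),
         ''rdegree'' := array_of_list (map (length \<circ> rpref I) rs),
         ''rpref'' := array_of_list (concat (map (rpref I) rs)),
         ''hdegree'' := array_of_list (map (length \<circ> hpref I) hs),
         ''hpref'' := array_of_list (concat (map (hpref I) hs))))"

text \<open>The entry \<open>0\<close> marks an unmatched resident; \<open>Suc h\<close> stands for hospital \<open>h\<close>.\<close>

definition output_matching :: "(nat, nat) hrlq \<Rightarrow> memory \<Rightarrow> (nat \<times> nat) set" where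
  "output_matching I s = {(r, h). r \<in> residents I \<and> s ''match'' r = Suc h}"

definition polynomial_time_computes ::
  "com \<Rightarrow> ((nat, nat) hrlq \<Rightarrow> bool) \<Rightarrow> ((nat, nat) hrlq \<Rightarrow> (nat \<times> nat) set \<Rightarrow> bool) \<Rightarrow> bool" where
  "polynomial_time_computes c P Q \<longleftrightarrow>
     (\<exists>p :: nat poly. \<forall>I. numbered_instance I \<and> P I \<longrightarrow>
        (\<exists>t s. runs c (input_memory I) t s \<and> t \<le> poly p (instance_size I) \<and>
               Q I (output_matching I s)))"

end

theory Submission
  imports Defs
begin

text \<open>
  Start from an assignment that fills every hospital exactly up to its lower quota. All other
  residents propose in the order of their lists; a full hospital that receives a proposal dismisses
  one of its initial residents if any is left, and its least preferred resident otherwise, and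
  dismissed residents propose from the top of their lists. Occupancies never decrease, so the
  outcome \<open>M\<close> is feasible. A proposer never blocks \<open>M\<close>, and a hospital keeps at most \<open>q\<^sup>-\<close> initial
  residents, so \<open>M\<close> is relaxed stable.

  For the ratio, let \<open>N\<close> be relaxed stable and let \<open>F\<close> be the set of hospitals that \<open>N\<close> assigns to
  residents unmatched in \<open>M\<close>. They have rejected a proposer, so in \<open>M\<close> they are full and hold
  proposers only. Hence \<open>|N| - |M|\<close> is at most the number of \<open>M\<close>-edges at \<open>F\<close>. As
  \<open>|M(h)| \<ge> q\<^sup>-(h)\<close>, a hospital \<open>h\<close> with \<open>|N(h)| > |M(h)|\<close> has \<open>|N(h)| - |M(h)|\<close> residents in
  \<open>N(h)\<close> that do not block \<open>N\<close>; each of them is matched in \<open>M\<close> outside \<open>F\<close>. Hence \<open>|N| - |M|\<close> is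
  also at most the number of \<open>M\<close>-edges outside \<open>F\<close>, and \<open>2 (|N| - |M|) \<le> |M|\<close>.

  The initial assignment is found by an auction. If all neighbours of a hospital \<open>h\<close> below its
  lower quota cost more than the number of residents, some positive price \<open>v\<close> below theirs is not
  taken. The residents dearer than \<open>v\<close> are then all the neighbours of \<open>h\<close> and of the hospitals
  that hold them, and they are too few for the lower quotas of these hospitals. So prices stay
  polynomial when a feasible matching exists.
\<close>

section \<open>Matchings\<close>

lemma precedes_nth:
  assumes "distinct xs" "i < length xs" "j < length xs"
  shows "precedes xs (xs ! i) (xs ! j) \<longleftrightarrow> i < j"
  using assms unfolding precedes_def by (metis nth_eq_iff_index_eq order.strict_trans)

lemma precedes_trans:
  assumes "distinct xs" "precedes xs a b" "precedes xs b c"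
  shows "precedes xs a c"
proof -
  obtain i j where 1: "i < j" "j < length xs" "xs ! i = a" "xs ! j = b"
    using assms(2) by (auto simp: precedes_def)
  obtain k l where 2: "k < l" "l < length xs" "xs ! k = b" "xs ! l = c"
    using assms(3) by (auto simp: precedes_def)
  have "k = j"
    using 1 2 assms(1) by (metis nth_eq_iff_index_eq order.strict_trans)
  then show ?thesis
    using 1 2 unfolding precedes_def by (metis order.strict_trans)
qed

lemma precedes_asym:
  assumes "distinct xs" "precedes xs a b"
  shows "\<not> precedes xs b a"
proof
  assume "precedes xs b a"
  then have "precedes xs a a" using precedes_trans[OF assms] by blast
  then show False using assms(1) by (auto simp: precedes_def nth_eq_iff_index_eq)
qed

locale hrlq =
  fixes I :: "('r, 'h) hrlq"
  assumes inst: "hrlq_instance I"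
begin

lemma finite_residents [simp]: "finite (residents I)"
  and finite_hospitals [simp]: "finite (hospitals I)"
  using inst by (auto simp: hrlq_instance_def)

lemma edgeD: "(r, h) \<in> edges I \<Longrightarrow> r \<in> residents I \<and> h \<in> hospitals I"
  using inst by (auto simp: hrlq_instance_def)

lemma finite_edges [simp]: "finite (edges I)"
proof -
  have "edges I \<subseteq> residents I \<times> hospitals I" using edgeD by auto
  then show ?thesis by (rule finite_subset) simp
qed

lemma rpref:
  assumes "r \<in> residents I"
  shows distinct_rpref: "distinct (rpref I r)"
    and set_rpref: "h \<in> set (rpref I r) \<longleftrightarrow> (r, h) \<in> edges I"
  using inst assms by (auto simp: hrlq_instance_def)

lemma hpref:
  assumes "h \<in> hospitals I"
  shows distinct_hpref: "distinct (hpref I h)"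
    and set_hpref: "r \<in> set (hpref I h) \<longleftrightarrow> (r, h) \<in> edges I"
  using inst assms by (auto simp: hrlq_instance_def)

lemma quota_le: "h \<in> hospitals I \<Longrightarrow> lquota I h \<le> uquota I h"
  using inst by (auto simp: hrlq_instance_def)

lemma rpref_nth_edge:
  assumes "r \<in> residents I" "i < length (rpref I r)"
  shows "(r, rpref I r ! i) \<in> edges I"
  using assms set_rpref nth_mem by blast

lemma matching_unique:
  assumes "matching I N" "(r, h) \<in> N" "(r, h') \<in> N"
  shows "h = h'"
proof (rule ccontr)
  assume neq: "h \<noteq> h'"
  have "{h. (r, h) \<in> N} \<subseteq> hospitals I" using assms(1) edgeD by (auto simp: matching_def)
  then have "finite {h. (r, h) \<in> N}" by (rule finite_subset) simp
  then have "card {h, h'} \<le> card {h. (r, h) \<in> N}" using assms by (intro card_mono) auto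
  moreover have "card {h. (r, h) \<in> N} \<le> 1"
    using assms edgeD by (auto simp: matching_def)
  ultimately show False using neq by simp
qed

lemma finite_residents_of:
  assumes "matching I N"
  shows "finite (residents_of N h)"
proof -
  have "residents_of N h \<subseteq> residents I" using assms edgeD by (auto simp: residents_of_def matching_def)
  then show ?thesis by (rule finite_subset) simp
qed

definition occupants :: "('r \<Rightarrow> 'h option) \<Rightarrow> 'h \<Rightarrow> 'r set" where
  "occupants m h = {r \<in> residents I. m r = Some h}"

definition graph :: "('r \<Rightarrow> 'h option) \<Rightarrow> ('r \<times> 'h) set" where
  "graph m = {(r, h). r \<in> residents I \<and> m r = Some h}"

lemma finite_occupants [simp]: "finite (occupants m h)"
  by (simp add: occupants_def)

lemma residents_of_graph [simp]: "residents_of (graph m) h = occupants m h"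
  by (auto simp: residents_of_def graph_def occupants_def)

lemma hospital_of_graph: "r \<in> residents I \<Longrightarrow> hospital_of (graph m) r = m r"
  by (cases "m r") (auto simp: hospital_of_def graph_def)

lemma occupants_assign:
  assumes "r \<in> residents I" "m r = None"
  shows "occupants (m(r := Some h)) h' = (if h' = h then insert r (occupants m h') else occupants m h')"
  using assms by (auto simp: occupants_def)

lemma occupants_release: "occupants (m(r := None)) h = occupants m h - {r}"
  by (auto simp: occupants_def)

lemma not_in_occupants: "m r = None \<Longrightarrow> r \<notin> occupants m h"
  by (auto simp: occupants_def)


subsection \<open>Meeting the lower quotas\<close>

text \<open>Residents are auctioned off to the hospitals below their lower quota: such a hospital buys the
  cheapest acceptable resident, whose price then goes up by one.\<close>

definition auction_inv :: "('r \<Rightarrow> 'h option) \<Rightarrow> ('r \<Rightarrow> nat) \<Rightarrow> bool" where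
  "auction_inv m p \<longleftrightarrow>
     (\<forall>r\<in>residents I. \<forall>h. m r = Some h \<longrightarrow> (r, h) \<in> edges I) \<and>
     (\<forall>h\<in>hospitals I. card (occupants m h) \<le> lquota I h) \<and>
     (\<forall>r\<in>residents I. m r = None \<longrightarrow> p r = 0) \<and>
     (\<forall>r\<in>residents I. \<forall>h r'. m r = Some h \<longrightarrow> (r', h) \<in> edges I \<longrightarrow> p r \<le> Suc (p r')) \<and>
     (\<forall>r\<in>residents I. p r \<le> Suc (card (residents I)))"

lemma cheap_neighbour_exists:
  assumes inv: "auction_inv m p" and feas: "feasible_matching I N"
    and h: "h \<in> hospitals I" and deficit: "card (occupants m h) < lquota I h"
  shows "\<exists>r. (r, h) \<in> edges I \<and> p r \<le> card (residents I)"
proof (rule ccontr)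
  assume "\<not> ?thesis"
  then have expensive: "\<And>r. (r, h) \<in> edges I \<Longrightarrow> card (residents I) < p r" by force
  have N_edges: "N \<subseteq> edges I" and N_lower: "\<And>h. h \<in> hospitals I \<Longrightarrow> lquota I h \<le> card (residents_of N h)"
    using feas by (auto simp: feasible_matching_def matching_def)
  have "residents_of N h \<noteq> {}"
    using N_lower[OF h] deficit by auto
  then obtain r0 where r0: "(r0, h) \<in> edges I"
    using N_edges by (auto simp: residents_of_def)
  have "\<exists>v\<in>{1..card (residents I)}. \<forall>r\<in>residents I. p r \<noteq> v"
  proof (rule ccontr)
    assume no_gap: "\<not> ?thesis"
    have "{1..card (residents I)} \<subseteq> p ` (residents I - {r0})"
    proof (intro subsetI)
      fix v assume v: "v \<in> {1..card (residents I)}"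
      with no_gap obtain r where "r \<in> residents I" "p r = v" by blast
      with v expensive[OF r0] show "v \<in> p ` (residents I - {r0})" by auto
    qed
    then have "card (residents I) \<le> card (p ` (residents I - {r0}))"
      using card_mono[of "p ` (residents I - {r0})" "{1..card (residents I)}"] by simp
    also have "\<dots> \<le> card (residents I - {r0})" by (simp add: card_image_le)
    also have "\<dots> < card (residents I)" using edgeD[OF r0] by (intro card_Diff1_less) auto
    finally show False by simp
  qed
  then obtain v where v: "1 \<le> v" "v \<le> card (residents I)" and gap: "\<And>r. r \<in> residents I \<Longrightarrow> p r \<noteq> v"
    by auto
  define S where "S = {r \<in> residents I. v < p r}"
  define T where "T = insert h {h'. \<exists>r\<in>S. m r = Some h'}"
  have T_hosp: "T \<subseteq> hospitals I"
    using h inv edgeD by (auto simp: T_def S_def auction_inv_def)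
  then have [simp]: "finite T" by (rule finite_subset) simp
  have "(r, h') \<in> edges I \<Longrightarrow> r \<in> S" if hT: "h' \<in> T" for r h'
  proof -
    assume e: "(r, h') \<in> edges I"
    then have r: "r \<in> residents I" using edgeD by blast
    have "v \<le> p r"
    proof (cases "h' = h")
      case True
      then show ?thesis using expensive e v by (meson order.trans less_imp_le)
    next
      case False
      then obtain q where q: "q \<in> residents I" "v < p q" "m q = Some h'"
        using hT by (auto simp: T_def S_def)
      then have "p q \<le> Suc (p r)" using inv e by (auto simp: auction_inv_def)
      then show ?thesis using q by simp
    qed
    then show "r \<in> S" using gap[OF r] r by (auto simp: S_def)
  qed
  then have N_S: "(\<Union>h'\<in>T. residents_of N h') \<subseteq> S"
    using N_edges by (auto simp: residents_of_def)
  have S_sub: "S \<subseteq> (\<Union>h'\<in>T. occupants m h')"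
  proof
    fix r assume r: "r \<in> S"
    then have "m r \<noteq> None" using inv v by (auto simp: auction_inv_def S_def)
    then show "r \<in> (\<Union>h'\<in>T. occupants m h')"
      using r by (auto simp: T_def S_def occupants_def)
  qed
  have N: "matching I N" using feas by (simp add: feasible_matching_def)
  have disj: "residents_of N h1 \<inter> residents_of N h2 = {}" if "h1 \<noteq> h2" for h1 h2
    using matching_unique[OF N] that by (auto simp: residents_of_def)
  have "(\<Sum>h'\<in>T. lquota I h') \<le> (\<Sum>h'\<in>T. card (residents_of N h'))"
    using N_lower T_hosp by (intro sum_mono) auto
  also have "\<dots> = card (\<Union>h'\<in>T. residents_of N h')"
    using disj finite_residents_of[OF N] by (subst card_UN_disjoint) auto
  also have "\<dots> \<le> card (\<Union>h'\<in>T. occupants m h')"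
    using N_S S_sub by (intro card_mono) auto
  also have "\<dots> \<le> (\<Sum>h'\<in>T. card (occupants m h'))"
    by (intro card_UN_le) simp
  also have "\<dots> < (\<Sum>h'\<in>T. lquota I h')"
  proof (rule sum_strict_mono_ex1)
    show "\<forall>h'\<in>T. card (occupants m h') \<le> lquota I h'"
      using inv T_hosp by (auto simp: auction_inv_def)
    show "\<exists>h'\<in>T. card (occupants m h') < lquota I h'"
      using deficit by (auto simp: T_def)
  qed simp
  finally show False by simp
qed

lemma auction_step:
  assumes inv: "auction_inv m p" and h: "h \<in> hospitals I"
    and deficit: "card (occupants m h) < lquota I h"
    and b: "(b, h) \<in> edges I" "p b \<le> card (residents I)"
    and cheapest: "\<And>r. (r, h) \<in> edges I \<Longrightarrow> p b \<le> p r"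
  shows "auction_inv (m(b := Some h)) (p(b := Suc (p b)))"
proof -
  have "card (occupants (m(b := Some h)) h') \<le> lquota I h'" if "h' \<in> hospitals I" for h'
  proof (cases "h' = h")
    case True
    have "occupants (m(b := Some h)) h \<subseteq> insert b (occupants m h)" by (auto simp: occupants_def)
    then have "card (occupants (m(b := Some h)) h) \<le> card (insert b (occupants m h))"
      by (intro card_mono) auto
    also have "\<dots> \<le> Suc (card (occupants m h))" by (simp add: card_insert_if)
    finally show ?thesis using True deficit by simp
  next
    case False
    have "occupants (m(b := Some h)) h' \<subseteq> occupants m h'" using False by (auto simp: occupants_def)
    then have "card (occupants (m(b := Some h)) h') \<le> card (occupants m h')" by (intro card_mono) auto
    then show ?thesis using inv that by (force simp: auction_inv_def)
  qed
  then show ?thesis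
    using inv b cheapest edgeD[OF b(1)] unfolding auction_inv_def
    by (auto simp: le_Suc_eq) (meson le_neq_implies_less Suc_leI)
qed

subsection \<open>Deferred acceptance\<close>

text \<open>\<open>k r\<close> is the number of proposals that \<open>r\<close> has made. A matched resident \<open>r\<close> with \<open>k r = 0\<close>
  still has the place that the auction gave him, and a hospital ranks him below all proposers.\<close>

definition proposal_inv :: "('r \<Rightarrow> 'h option) \<Rightarrow> ('r \<Rightarrow> nat) \<Rightarrow> bool" where
  "proposal_inv m k \<longleftrightarrow>
     (\<forall>r\<in>residents I. \<forall>h. m r = Some h \<longrightarrow> (r, h) \<in> edges I) \<and>
     (\<forall>h\<in>hospitals I. lquota I h \<le> card (occupants m h) \<and> card (occupants m h) \<le> uquota I h \<and>
        card {r \<in> occupants m h. k r = 0} \<le> lquota I h) \<and>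
     (\<forall>r\<in>residents I. k r \<le> length (rpref I r) \<and>
        (\<forall>h. m r = Some h \<longrightarrow> k r \<noteq> 0 \<longrightarrow> rpref I r ! (k r - 1) = h) \<and>
        (\<forall>i < k r. m r \<noteq> Some (rpref I r ! i) \<longrightarrow>
           card (occupants m (rpref I r ! i)) = uquota I (rpref I r ! i) \<and>
           (\<forall>r'\<in>occupants m (rpref I r ! i).
              k r' \<noteq> 0 \<and> precedes (hpref I (rpref I r ! i)) r' r)))"

lemma proposal_inv_init:
  assumes "\<And>r h. r \<in> residents I \<Longrightarrow> m r = Some h \<Longrightarrow> (r, h) \<in> edges I"
    and "\<And>h. h \<in> hospitals I \<Longrightarrow> card (occupants m h) = lquota I h"
  shows "proposal_inv m (\<lambda>_. 0)"
  using assms quota_le by (auto simp: proposal_inv_def)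

lemma
  assumes "proposal_inv m k"
  shows proposal_inv_edge: "r \<in> residents I \<Longrightarrow> m r = Some h \<Longrightarrow> (r, h) \<in> edges I"
    and proposal_inv_lower: "h \<in> hospitals I \<Longrightarrow> lquota I h \<le> card (occupants m h)"
    and proposal_inv_upper: "h \<in> hospitals I \<Longrightarrow> card (occupants m h) \<le> uquota I h"
    and proposal_inv_idle: "h \<in> hospitals I \<Longrightarrow> card {r \<in> occupants m h. k r = 0} \<le> lquota I h"
    and proposal_inv_le: "r \<in> residents I \<Longrightarrow> k r \<le> length (rpref I r)"
    and proposal_inv_last:
      "r \<in> residents I \<Longrightarrow> m r = Some h \<Longrightarrow> k r \<noteq> 0 \<Longrightarrow> rpref I r ! (k r - 1) = h"
    and proposal_inv_full: "r \<in> residents I \<Longrightarrow> i < k r \<Longrightarrow> m r \<noteq> Some (rpref I r ! i) \<Longrightarrow>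
      card (occupants m (rpref I r ! i)) = uquota I (rpref I r ! i)"
    and proposal_inv_rejected: "r \<in> residents I \<Longrightarrow> i < k r \<Longrightarrow> m r \<noteq> Some (rpref I r ! i) \<Longrightarrow>
      r' \<in> occupants m (rpref I r ! i) \<Longrightarrow> k r' \<noteq> 0 \<and> precedes (hpref I (rpref I r ! i)) r' r"
  using assms unfolding proposal_inv_def by blast+

lemma proposal_accept:
  assumes inv: "proposal_inv m k" and r: "r \<in> residents I" "m r = None" "k r < length (rpref I r)"
    and room: "card (occupants m (rpref I r ! k r)) < uquota I (rpref I r ! k r)"
  shows "proposal_inv (m(r := Some (rpref I r ! k r))) (k(r := Suc (k r)))"
proof -
  define h where "h = rpref I r ! k r"
  define m' where "m' = m(r := Some h)"
  define k' where "k' = k(r := Suc (k r))"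
  have e: "(r, h) \<in> edges I" unfolding h_def using r by (intro rpref_nth_edge)
  have occ: "occupants m' h' = (if h' = h then insert r (occupants m h') else occupants m h')" for h'
    unfolding m'_def by (rule occupants_assign) (use r in auto)
  have r_notin: "r \<notin> occupants m h'" for h' using r by (simp add: not_in_occupants)
  have "proposal_inv m' k'"
    unfolding proposal_inv_def
  proof (intro conjI ballI allI impI)
    fix r' h' assume "r' \<in> residents I" "m' r' = Some h'"
    then show "(r', h') \<in> edges I"
      using e proposal_inv_edge[OF inv] by (auto simp: m'_def split: if_splits)
  next
    fix h' assume h': "h' \<in> hospitals I"
    show "lquota I h' \<le> card (occupants m' h')"
      using proposal_inv_lower[OF inv h'] r_notin by (auto simp: occ)
    show "card (occupants m' h') \<le> uquota I h'"
      using proposal_inv_upper[OF inv h'] r_notin room by (simp add: occ h_def)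
    have "{x \<in> occupants m' h'. k' x = 0} = {x \<in> occupants m h'. k x = 0}"
      using r_notin by (auto simp: occ k'_def split: if_splits)
    then show "card {x \<in> occupants m' h'. k' x = 0} \<le> lquota I h'"
      using proposal_inv_idle[OF inv h'] by simp
  next
    fix r' assume r': "r' \<in> residents I"
    show "k' r' \<le> length (rpref I r')"
      using proposal_inv_le[OF inv r'] r by (simp add: k'_def)
    show "rpref I r' ! (k' r' - 1) = h'" if "m' r' = Some h'" "k' r' \<noteq> 0" for h'
      using that proposal_inv_last[OF inv r'] by (auto simp: m'_def k'_def h_def split: if_splits)
    fix i assume i: "i < k' r'" "m' r' \<noteq> Some (rpref I r' ! i)"
    let ?h = "rpref I r' ! i"
    have i': "i < k r'" "m r' \<noteq> Some ?h"
      using i r by (auto simp: k'_def m'_def h_def less_Suc_eq split: if_splits)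
    have h: "?h \<noteq> h"
      using proposal_inv_full[OF inv r' i'] room by (auto simp: h_def)
    then have occ': "occupants m' ?h = occupants m ?h" by (simp add: occ)
    show "card (occupants m' ?h) = uquota I ?h"
      using proposal_inv_full[OF inv r' i'] occ' by simp
    fix x assume x: "x \<in> occupants m' ?h"
    then show "k' x \<noteq> 0" "precedes (hpref I ?h) x r'"
      using proposal_inv_rejected[OF inv r' i'] unfolding occ' by (auto simp: k'_def)
  qed
  then show ?thesis unfolding m'_def k'_def h_def .
qed

lemma proposal_replace:
  fixes m k r
  defines "h \<equiv> rpref I r ! k r"
  defines "m' \<equiv> m(r := Some h)"
  defines "k' \<equiv> k(r := Suc (k r))"
  assumes inv: "proposal_inv m k" and r: "r \<in> residents I" "m r = None" "k r < length (rpref I r)"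
    and full: "uquota I h \<le> card (occupants m h)"
    and v: "v \<in> occupants m' h"
    and worst: "k' v = 0 \<or> (\<forall>x\<in>occupants m' h. k' x \<noteq> 0 \<and> (x = v \<or> precedes (hpref I h) x v))"
  shows "proposal_inv (m'(v := None)) k'"
proof -
  have e: "(r, h) \<in> edges I" unfolding h_def using r by (intro rpref_nth_edge)
  then have h: "h \<in> hospitals I" using edgeD by blast
  have occ': "occupants m' h' = (if h' = h then insert r (occupants m h') else occupants m h')" for h'
    unfolding m'_def by (rule occupants_assign) (use r in auto)
  have r_notin: "r \<notin> occupants m h'" for h' using r by (simp add: not_in_occupants)
  have v_notin: "v \<notin> occupants m h'" if "h' \<noteq> h" for h'
    using v that r_notin by (auto simp: occupants_def m'_def split: if_splits)
  define m'' where "m'' = m'(v := None)"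
  have occ: "occupants m'' h' = (if h' = h then insert r (occupants m h') - {v} else occupants m h')"
    for h' using v_notin by (auto simp: m''_def occupants_release occ')
  have card_h: "card (occupants m h) = uquota I h"
    using full proposal_inv_upper[OF inv h] by simp
  have card_occ: "card (occupants m'' h') = card (occupants m h')" for h'
    using v r_notin by (auto simp: occ occ' card_Diff_singleton_if)
  have vR: "v \<in> residents I" "m' v = Some h" using v by (auto simp: occupants_def)
  have "proposal_inv m'' k'"
    unfolding proposal_inv_def
  proof (intro conjI ballI allI impI)
    fix r' h' assume "r' \<in> residents I" "m'' r' = Some h'"
    then show "(r', h') \<in> edges I"
      using e proposal_inv_edge[OF inv] by (auto simp: m''_def m'_def split: if_splits)
  next
    fix h' assume h': "h' \<in> hospitals I"
    show "lquota I h' \<le> card (occupants m'' h')"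
      using proposal_inv_lower[OF inv h'] by (simp add: card_occ)
    show "card (occupants m'' h') \<le> uquota I h'"
      using proposal_inv_upper[OF inv h'] by (simp add: card_occ)
    have "{x \<in> occupants m'' h'. k' x = 0} \<subseteq> {x \<in> occupants m h'. k x = 0}"
      using r_notin by (auto simp: occ k'_def split: if_splits)
    then have "card {x \<in> occupants m'' h'. k' x = 0} \<le> card {x \<in> occupants m h'. k x = 0}"
      by (intro card_mono) auto
    then show "card {x \<in> occupants m'' h'. k' x = 0} \<le> lquota I h'"
      using proposal_inv_idle[OF inv h'] by simp
  next
    fix r' assume r': "r' \<in> residents I"
    show "k' r' \<le> length (rpref I r')"
      using proposal_inv_le[OF inv r'] r by (simp add: k'_def)
    show "rpref I r' ! (k' r' - 1) = h'" if "m'' r' = Some h'" "k' r' \<noteq> 0" for h'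
      using that proposal_inv_last[OF inv r']
      by (auto simp: m''_def m'_def k'_def h_def split: if_splits)
    fix i assume i: "i < k' r'" "m'' r' \<noteq> Some (rpref I r' ! i)"
    let ?h = "rpref I r' ! i"
    have *: "card (occupants m ?h) = uquota I ?h \<and>
       (\<forall>x\<in>occupants m'' ?h. k' x \<noteq> 0 \<and> precedes (hpref I ?h) x r')"
    proof (cases "r' = v \<and> ?h = h")
      case True
      then have "k' v \<noteq> 0" using i by auto
      then show ?thesis using worst True card_h by (auto simp: occ occ')
    next
      case False
      have i': "i < k r' \<and> m r' \<noteq> Some ?h"
      proof (cases "r' = r")
        case True
        have "?h \<noteq> h"
        proof
          assume "?h = h"
          with i(2) True have "v = r" by (auto simp: m''_def m'_def split: if_splits)
          with False True \<open>?h = h\<close> show False by simp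
        qed
        then show ?thesis using i True r by (auto simp: k'_def h_def less_Suc_eq)
      next
        case r'r: False
        show ?thesis
        proof (cases "r' = v")
          case True
          then have "m r' = Some h" using vR r'r by (simp add: m'_def)
          then show ?thesis using i r'r False True by (simp add: k'_def)
        next
          case False
          then show ?thesis using i r'r by (simp add: k'_def m''_def m'_def)
        qed
      qed
      note full' = proposal_inv_full[OF inv r' conjunct1[OF i'] conjunct2[OF i']]
      note rej = proposal_inv_rejected[OF inv r' conjunct1[OF i'] conjunct2[OF i']]
      have "k' x \<noteq> 0 \<and> precedes (hpref I ?h) x r'" if x: "x \<in> occupants m'' ?h" for x
      proof (cases "x = r")
        case False
        then have "x \<in> occupants m ?h" using x by (auto simp: occ split: if_splits)
        then show ?thesis using rej by (simp add: k'_def)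
      next
        case True
        then have hh: "?h = h" and "v \<noteq> r"
          using x r_notin by (auto simp: occ split: if_splits)
        then have "v \<in> occupants m ?h" using v by (simp add: occ')
        then have v': "k v \<noteq> 0" "precedes (hpref I h) v r'" using rej hh by auto
        then have "precedes (hpref I h) r v"
          using worst \<open>v \<noteq> r\<close> by (auto simp: occ' k'_def)
        then show ?thesis
          using precedes_trans[OF distinct_hpref[OF h] _ v'(2)] True hh by (simp add: k'_def)
      qed
      then show ?thesis using full' by blast
    qed
    then show "card (occupants m'' ?h) = uquota I ?h" by (simp add: card_occ)
    fix x assume "x \<in> occupants m'' ?h"
    then show "k' x \<noteq> 0" "precedes (hpref I ?h) x r'" using * by auto
  qed
  then show ?thesis unfolding m''_def .
qed

definition finished :: "('r \<Rightarrow> 'h option) \<Rightarrow> ('r \<Rightarrow> nat) \<Rightarrow> bool" where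
  "finished m k \<longleftrightarrow> (\<forall>r\<in>residents I. m r = None \<longrightarrow> length (rpref I r) \<le> k r)"

lemma proposal_worst_exists:
  assumes h: "h \<in> hospitals I" and e: "\<And>r. r \<in> occupants m h \<Longrightarrow> (r, h) \<in> edges I"
    and ne: "occupants m h \<noteq> {}"
  shows "\<exists>v\<in>occupants m h. k v = (0::nat) \<or>
    (\<forall>x\<in>occupants m h. k x \<noteq> 0 \<and> (x = v \<or> precedes (hpref I h) x v))"
proof (cases "\<exists>v\<in>occupants m h. k v = 0")
  case False
  let ?A = "{i. i < length (hpref I h) \<and> hpref I h ! i \<in> occupants m h}"
  have "\<exists>i. i \<in> ?A"
  proof -
    obtain x where x: "x \<in> occupants m h" using ne by blast
    then have "x \<in> set (hpref I h)" using e set_hpref[OF h] by blast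
    then show ?thesis using x by (auto simp: in_set_conv_nth)
  qed
  then have "Max ?A \<in> ?A" by (intro Max_in) auto
  moreover have "x = hpref I h ! Max ?A \<or> precedes (hpref I h) x (hpref I h ! Max ?A)"
    if "x \<in> occupants m h" for x
  proof -
    have "x \<in> set (hpref I h)" using that e set_hpref[OF h] by blast
    then obtain j where j: "j < length (hpref I h)" "x = hpref I h ! j" by (auto simp: in_set_conv_nth)
    then have "j \<le> Max ?A" using that by (intro Max_ge) auto
    moreover have "Max ?A < length (hpref I h)" using \<open>Max ?A \<in> ?A\<close> by blast
    ultimately show ?thesis
      using j precedes_nth[OF distinct_hpref[OF h], of j "Max ?A"] by (metis le_less)
  qed
  ultimately show ?thesis using False by (intro bexI[of _ "hpref I h ! Max ?A"]) simp_all
qed auto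

lemma proposal_terminates:
  assumes "proposal_inv m k"
  shows "\<exists>m k. proposal_inv m k \<and> finished m k"
  using assms
proof (induction "\<Sum>r\<in>residents I. length (rpref I r) - k r" arbitrary: m k rule: less_induct)
  case less
  show ?case
  proof (cases "finished m k")
    case False
    then obtain r where r: "r \<in> residents I" "m r = None" "k r < length (rpref I r)"
      by (auto simp: finished_def not_le)
    define h where "h = rpref I r ! k r"
    define k' where "k' = k(r := Suc (k r))"
    have e: "(r, h) \<in> edges I" unfolding h_def using r by (intro rpref_nth_edge)
    have decr: "(\<Sum>r\<in>residents I. length (rpref I r) - k' r) < (\<Sum>r\<in>residents I. length (rpref I r) - k r)"
      using r by (intro sum_strict_mono_ex1) (auto simp: k'_def)
    have "\<exists>m'. proposal_inv m' k'"
    proof (cases "card (occupants m h) < uquota I h")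
      case True
      then show ?thesis using proposal_accept[OF less.prems r] by (auto simp: h_def k'_def)
    next
      case False
      have "\<exists>v\<in>occupants (m(r := Some h)) h. k' v = 0 \<or>
          (\<forall>x\<in>occupants (m(r := Some h)) h. k' x \<noteq> 0 \<and> (x = v \<or> precedes (hpref I h) x v))"
        using e edgeD[OF e] proposal_inv_edge[OF less.prems] r
        by (intro proposal_worst_exists) (auto simp: occupants_def split: if_splits)
      then show ?thesis
        using proposal_replace[OF less.prems r] False unfolding h_def k'_def not_less by blast
    qed
    then show ?thesis using less.hyps[OF decr] by blast
  qed (use less.prems in blast)
qed

subsection \<open>The outcome\<close>

lemma not_blocking_graph:
  assumes inv: "proposal_inv m k" and fin: "finished m k"
    and r: "r \<in> residents I" "m r = None \<or> k r \<noteq> 0"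
  shows "\<not> blocking_pair I (graph m) r h"
proof
  assume bp: "blocking_pair I (graph m) r h"
  then have e: "(r, h) \<in> edges I" and nm: "m r \<noteq> Some h"
    and pref: "resident_prefers I r h (m r)"
    and h: "card (occupants m h) < uquota I h \<or> (\<exists>r'\<in>occupants m h. precedes (hpref I h) r r')"
    using r by (auto simp: blocking_pair_def graph_def hospital_of_graph[unfolded graph_def]
        under_subscribed_def residents_of_graph[unfolded graph_def])
  have "h \<in> set (rpref I r)" using e set_rpref[OF r(1)] by simp
  then obtain i where i: "i < length (rpref I r)" "h = rpref I r ! i" by (auto simp: in_set_conv_nth)
  have "i < k r"
  proof (cases "m r")
    case None
    then show ?thesis using fin r i by (auto simp: finished_def)
  next
    case (Some h')
    then have k: "k r \<noteq> 0" "rpref I r ! (k r - 1) = h'" "k r - 1 < length (rpref I r)"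
      using r proposal_inv_last[OF inv] proposal_inv_le[OF inv r(1)] by auto
    have "precedes (rpref I r) (rpref I r ! i) (rpref I r ! (k r - 1))"
      using pref Some k i by (simp add: resident_prefers_def)
    then show ?thesis
      using precedes_nth[OF distinct_rpref[OF r(1)] i(1) k(3)] by simp
  qed
  then have "card (occupants m h) = uquota I h" "\<And>r'. r' \<in> occupants m h \<Longrightarrow> precedes (hpref I h) r' r"
    using proposal_inv_full[OF inv r(1)] proposal_inv_rejected[OF inv r(1)] nm i by auto
  then obtain r' where "precedes (hpref I h) r r'" "precedes (hpref I h) r' r" using h by auto
  moreover have "h \<in> hospitals I" using edgeD[OF e] by simp
  ultimately show False using precedes_asym[OF distinct_hpref] by metis
qed

lemma matching_graph:
  assumes "proposal_inv m k"
  shows "matching I (graph m)"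
proof -
  have "card {h. (r, h) \<in> graph m} \<le> 1" for r
  proof -
    have "{h. (r, h) \<in> graph m} \<subseteq> set_option (m r)" by (auto simp: graph_def)
    then have "card {h. (r, h) \<in> graph m} \<le> card (set_option (m r))" by (intro card_mono) auto
    also have "\<dots> \<le> 1" by (cases "m r") auto
    finally show ?thesis .
  qed
  moreover have "graph m \<subseteq> edges I"
    using proposal_inv_edge[OF assms] by (auto simp: graph_def)
  ultimately show ?thesis
    using proposal_inv_upper[OF assms] by (simp add: matching_def)
qed

lemma feasible_graph: "proposal_inv m k \<Longrightarrow> feasible_matching I (graph m)"
  using matching_graph proposal_inv_lower by (auto simp: feasible_matching_def)

lemma relaxed_stable_graph:
  assumes inv: "proposal_inv m k" and fin: "finished m k"
  shows "relaxed_stable I (graph m)"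
  unfolding relaxed_stable_def
proof (intro conjI ballI impI)
  fix h assume h: "h \<in> hospitals I"
  have "{r \<in> occupants m h. \<exists>h'. blocking_pair I (graph m) r h'} \<subseteq> {r \<in> occupants m h. k r = 0}"
    using not_blocking_graph[OF inv fin] by (auto simp: occupants_def)
  then have "card {r \<in> occupants m h. \<exists>h'. blocking_pair I (graph m) r h'}
      \<le> card {r \<in> occupants m h. k r = 0}" by (intro card_mono) auto
  then show "card {r \<in> residents_of (graph m) h. \<exists>h'. blocking_pair I (graph m) r h'} \<le> lquota I h"
    using proposal_inv_idle[OF inv h] by simp
next
  fix r assume "r \<in> residents I" "hospital_of (graph m) r = None"
  then show "\<not> (\<exists>h. blocking_pair I (graph m) r h)"
    using not_blocking_graph[OF inv fin] by (simp add: hospital_of_graph)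
qed

lemma relaxed_stable_exists:
  assumes feas: "feasible_matching I N"
  shows "\<exists>M. feasible_matching I M \<and> relaxed_stable I M"
proof -
  have N: "N \<subseteq> edges I" "matching I N" "\<And>h. h \<in> hospitals I \<Longrightarrow> lquota I h \<le> card (residents_of N h)"
    using feas by (auto simp: feasible_matching_def matching_def)
  have "\<exists>A. A \<subseteq> residents_of N h \<and> card A = lquota I h" if "h \<in> hospitals I" for h
    using obtain_subset_with_card_n[OF N(3)[OF that]] by metis
  then obtain A where A: "\<And>h. h \<in> hospitals I \<Longrightarrow> A h \<subseteq> residents_of N h \<and> card (A h) = lquota I h"
    by metis
  define m where "m r = (if \<exists>h\<in>hospitals I. r \<in> A h then Some (SOME h. h \<in> hospitals I \<and> r \<in> A h) else None)" for r
  have m: "m r = Some h \<longleftrightarrow> h \<in> hospitals I \<and> r \<in> A h" for r h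
  proof
    assume "m r = Some h"
    then show "h \<in> hospitals I \<and> r \<in> A h"
      using someI_ex[of "\<lambda>h. h \<in> hospitals I \<and> r \<in> A h"]
      by (auto simp: m_def split: if_splits)
  next
    assume h: "h \<in> hospitals I \<and> r \<in> A h"
    have "h' = h" if "h' \<in> hospitals I \<and> r \<in> A h'" for h'
    proof (rule matching_unique[OF N(2)])
      show "(r, h') \<in> N" using A that by (auto simp: residents_of_def)
      show "(r, h) \<in> N" using A h by (auto simp: residents_of_def)
    qed
    then have "(SOME h. h \<in> hospitals I \<and> r \<in> A h) = h" 
      using h by (intro some_equality) blast+
    then show "m r = Some h" using h by (auto simp: m_def)
  qed
  have "proposal_inv m (\<lambda>_. 0)"
  proof (rule proposal_inv_init)
    show "(r, h) \<in> edges I" if "m r = Some h" for r h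
      using that A N(1) by (auto simp: m residents_of_def)
    fix h assume h: "h \<in> hospitals I"
    have "occupants m h = A h"
      using A[OF h] h N(1) edgeD by (auto simp: occupants_def m residents_of_def)
    then show "card (occupants m h) = lquota I h" using A[OF h] by simp
  qed
  then obtain m k where "proposal_inv m k" "finished m k" using proposal_terminates by blast
  then show ?thesis using feasible_graph relaxed_stable_graph by blast
qed

lemma card_matching:
  assumes "matching I M"
  shows "card M = (\<Sum>h\<in>hospitals I. card (residents_of M h))"
proof -
  have "M = (\<lambda>(h, r). (r, h)) ` (SIGMA h:hospitals I. residents_of M h)"
    using assms edgeD by (force simp: residents_of_def image_iff matching_def)
  then have "card M = card ((\<lambda>(h, r). (r, h)) ` (SIGMA h:hospitals I. residents_of M h))" by simp
  also have "\<dots> = card (SIGMA h:hospitals I. residents_of M h)"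
    by (intro card_image) (auto simp: inj_on_def)
  also have "\<dots> = (\<Sum>h\<in>hospitals I. card (residents_of M h))"
    using finite_residents_of[OF assms] by simp
  finally show ?thesis .
qed

lemma card_le_three_halves:
  assumes inv: "proposal_inv m k" and fin: "finished m k"
    and N: "matching I N" "relaxed_stable I N"
  shows "2 * card N \<le> 3 * card (graph m)"
proof -
  have N_edges: "N \<subseteq> edges I" and N_upper: "\<And>h. h \<in> hospitals I \<Longrightarrow> card (residents_of N h) \<le> uquota I h"
    using N by (auto simp: matching_def)
  note N_unique = matching_unique[OF N(1)] and fin_N [simp] = finite_residents_of[OF N(1)]
  have N_hosp: "hospital_of N r = Some h" if "(r, h) \<in> N" for r h
    using that N_unique by (auto simp: hospital_of_def intro!: the_equality)
  define B where "B h = {r \<in> residents_of N h. \<exists>h'. blocking_pair I N r h'}" for h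
  have card_B: "card (B h) \<le> lquota I h" if "h \<in> hospitals I" for h
    using N(2) that by (auto simp: relaxed_stable_def B_def)
  define F where "F = {h \<in> hospitals I. \<exists>r\<in>residents I. (r, h) \<in> N \<and> m r = None}"
  have F_hosp: "F \<subseteq> hospitals I" by (auto simp: F_def)
  have [simp]: "finite F" using F_hosp by (rule finite_subset) simp
  have settled: "card (occupants m h) = uquota I h \<and>
      (\<forall>r'\<in>occupants m h. k r' \<noteq> 0 \<and> precedes (hpref I h) r' r)"
    if "r \<in> residents I" "(r, h) \<in> edges I" "m r = None" for r h
  proof -
    have "h \<in> set (rpref I r)" using that set_rpref by simp
    then obtain i where i: "i < length (rpref I r)" "h = rpref I r ! i" by (auto simp: in_set_conv_nth)
    then have "i < k r" using fin that by (auto simp: finished_def)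
    then show ?thesis
      using proposal_inv_full[OF inv that(1)] proposal_inv_rejected[OF inv that(1)] i that(3) by auto
  qed
  have full_F: "card (occupants m h) = uquota I h" if "h \<in> F" for h
    using that settled N_edges by (auto simp: F_def)
  define d where "d h = card (residents_of N h) - card (occupants m h)" for h
  have "\<exists>X. X \<subseteq> residents_of N h - B h \<and> card X = d h" if "h \<in> hospitals I" for h
  proof -
    have "d h \<le> card (residents_of N h) - card (B h)"
      using card_B[OF that] proposal_inv_lower[OF inv that] by (simp add: d_def)
    also have "\<dots> = card (residents_of N h - B h)"
      by (intro card_Diff_subset[symmetric]) (auto simp: B_def)
    finally show ?thesis using obtain_subset_with_card_n by metis
  qed
  then obtain X where X: "\<And>h. h \<in> hospitals I \<Longrightarrow> X h \<subseteq> residents_of N h - B h \<and> card (X h) = d h"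
    by metis
  \<comment> \<open>If \<open>M(x) = h'\<close> were the \<open>N\<close>-partner of a resident unmatched in \<open>M\<close>, then \<open>(x, h')\<close> would block \<open>N\<close>.\<close>
  have X_matched: "\<exists>h'\<in>hospitals I - F. x \<in> occupants m h'" if h: "h \<in> hospitals I" and x: "x \<in> X h" for h x
  proof -
    have xN: "(x, h) \<in> N" and xB: "\<And>h'. \<not> blocking_pair I N x h'"
      using X[OF h] x by (auto simp: B_def residents_of_def)
    then have xe: "(x, h) \<in> edges I" and xR: "x \<in> residents I" using N_edges edgeD by blast+
    have "finite (X h)"
      using X[OF h] finite_subset[of "X h" "residents_of N h - B h"] by simp
    then have "card (X h) \<noteq> 0" using x by auto
    then have under: "card (occupants m h) < uquota I h"
      using X[OF h] N_upper[OF h] by (auto simp: d_def)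
    then have "m x \<noteq> None" using settled[OF xR xe] by auto
    then obtain h' where h': "m x = Some h'" by auto
    then have xe': "(x, h') \<in> edges I" using proposal_inv_edge[OF inv xR] by blast
    have "h' \<notin> F"
    proof
      assume hF: "h' \<in> F"
      then obtain r where r: "r \<in> residents I" "(r, h') \<in> N" "m r = None" by (auto simp: F_def)
      have xocc: "x \<in> occupants m h'" using xR h' by (simp add: occupants_def)
      then have x': "k x \<noteq> 0" "precedes (hpref I h') x r"
        using settled[OF r(1) _ r(3)] r(2) N_edges by auto
      have neq: "h' \<noteq> h" using under full_F[OF hF] by auto
      have "\<not> precedes (rpref I x) h h'"
      proof
        assume "precedes (rpref I x) h h'"
        then have "blocking_pair I (graph m) x h"
          using xe h' neq xR under
          by (auto simp: blocking_pair_def hospital_of_graph resident_prefers_def under_subscribed_def)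
            (auto simp: graph_def)
        then show False using not_blocking_graph[OF inv fin xR] x' by blast
      qed
      moreover obtain i j where "i < length (rpref I x)" "rpref I x ! i = h'"
        "j < length (rpref I x)" "rpref I x ! j = h"
        using xe xe' set_rpref[OF xR] by (metis in_set_conv_nth)
      ultimately have "precedes (rpref I x) h' h"
        using neq precedes_nth[OF distinct_rpref[OF xR]] by (metis linorder_neqE_nat)
      then have "blocking_pair I N x h'"
        using xe' xN N_unique neq N_hosp[OF xN] x' r(2)
        by (auto simp: blocking_pair_def resident_prefers_def residents_of_def)
      then show False using xB by blast
    qed
    then show ?thesis using h' xe' xR edgeD by (auto simp: occupants_def)
  qed
  have X_disj: "X h \<inter> X h' = {}" if "h \<in> hospitals I" "h' \<in> hospitals I" "h \<noteq> h'" for h h'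
  proof -
    have "X h \<subseteq> residents_of N h" "X h' \<subseteq> residents_of N h'" using X that by blast+
    then show ?thesis using N_unique that(3) unfolding residents_of_def by blast
  qed
  have card_N: "card N = (\<Sum>h\<in>hospitals I. card (residents_of N h))"
    using N(1) by (rule card_matching)
  have M_edges: "graph m \<subseteq> edges I" using matching_graph[OF inv] by (simp add: matching_def)
  have card_M: "card (graph m) = (\<Sum>h\<in>hospitals I. card (occupants m h))"
    using card_matching[OF matching_graph[OF inv]] by simp
  have "card N \<le> (\<Sum>h\<in>hospitals I. card (occupants m h) + d h)"
    unfolding card_N by (intro sum_mono) (simp add: d_def)
  also have "\<dots> = card (graph m) + (\<Sum>h\<in>hospitals I. card (X h))"
    using X by (simp add: sum.distrib card_M)
  also have "(\<Sum>h\<in>hospitals I. card (X h)) = card (\<Union>h\<in>hospitals I. X h)"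
  proof (rule card_UN_disjoint[symmetric])
    show "\<forall>h\<in>hospitals I. finite (X h)"
      using X by (meson fin_N finite_Diff finite_subset)
  qed (use X_disj in auto)
  also have "\<dots> \<le> card (\<Union>h\<in>hospitals I - F. occupants m h)"
    using X_matched by (intro card_mono) auto
  also have "\<dots> \<le> (\<Sum>h\<in>hospitals I - F. card (occupants m h))"
    by (intro card_UN_le) simp
  finally have 1: "card N \<le> card (graph m) + (\<Sum>h\<in>hospitals I - F. card (occupants m h))"
    by simp
  have "fst ` N \<subseteq> fst ` graph m \<union> (\<Union>h\<in>F. residents_of N h)"
  proof
    fix r assume "r \<in> fst ` N"
    then obtain h where h: "(r, h) \<in> N" by auto
    then have rh: "r \<in> residents I" "h \<in> hospitals I" using N_edges edgeD by blast+
    show "r \<in> fst ` graph m \<union> (\<Union>h\<in>F. residents_of N h)"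
      using h rh by (cases "m r") (force simp: F_def residents_of_def graph_def image_iff)+
  qed
  then have "card (fst ` N) \<le> card (fst ` graph m \<union> (\<Union>h\<in>F. residents_of N h))"
    using finite_subset[OF M_edges] by (intro card_mono) auto
  also have "\<dots> \<le> card (fst ` graph m) + card (\<Union>h\<in>F. residents_of N h)" by (rule card_Un_le)
  also have "card (fst ` graph m) \<le> card (graph m)"
    using finite_subset[OF M_edges] by (intro card_image_le) auto
  also have "card (\<Union>h\<in>F. residents_of N h) \<le> (\<Sum>h\<in>F. card (residents_of N h))"
    by (intro card_UN_le) simp
  also have "\<dots> \<le> (\<Sum>h\<in>F. card (occupants m h))"
    using N_upper full_F F_hosp by (intro sum_mono) auto
  also have "card (fst ` N) = card N"
    using N_unique by (intro card_image) (auto simp: inj_on_def)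
  finally have 2: "card N \<le> card (graph m) + (\<Sum>h\<in>F. card (occupants m h))"
    by simp
  have "(\<Sum>h\<in>hospitals I. card (occupants m h)) =
      (\<Sum>h\<in>hospitals I - F. card (occupants m h)) + (\<Sum>h\<in>F. card (occupants m h))"
    using F_hosp by (intro sum.subset_diff) auto
  then show ?thesis using 1 2 card_M by simp
qed

lemma approximation_graph:
  assumes inv: "proposal_inv m k" and fin: "finished m k"
  shows "real (card (graph m)) \<ge> 2 / 3 * real (max_feasible_relaxed_stable_size I)"
proof -
  let ?A = "{M. feasible_matching I M \<and> relaxed_stable I M}"
  have "?A \<subseteq> Pow (edges I)" by (auto simp: feasible_matching_def matching_def)
  then have "finite ?A" by (rule finite_subset) simp
  moreover have "graph m \<in> ?A" using feasible_graph[OF inv] relaxed_stable_graph[OF inv fin] by simp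
  ultimately have "Max (card ` ?A) \<in> card ` ?A" by (intro Max_in) auto
  then obtain N where N: "N \<in> ?A" "max_feasible_relaxed_stable_size I = card N"
    by (auto simp: max_feasible_relaxed_stable_size_def)
  then have "2 * card N \<le> 3 * card (graph m)"
    using card_le_three_halves[OF inv fin] by (auto simp: feasible_matching_def)
  then show ?thesis using N by simp
qed

end

section \<open>Programs\<close>

definition wp :: "com \<Rightarrow> (nat \<Rightarrow> memory \<Rightarrow> bool) \<Rightarrow> memory \<Rightarrow> bool" where
  "wp c Q s \<longleftrightarrow> (\<exists>t s'. runs c s t s' \<and> Q t s')"

lemma wp_mono: "wp c Q s \<Longrightarrow> (\<And>t s'. Q t s' \<Longrightarrow> Q' t s') \<Longrightarrow> wp c Q' s"
  by (auto simp: wp_def)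

lemma wp_Skip [simp]: "wp Skip Q s \<longleftrightarrow> Q 1 s"
  unfolding wp_def by (metis runs.Skip runs_deterministic)

lemma wp_Store [simp]: "wp (Store x a b) Q s \<longleftrightarrow> Q 1 (s(x := (s x)(aval a s := aval b s)))"
  unfolding wp_def by (metis runs.Store runs_deterministic)

lemma wp_Seq [simp]: "wp (Seq c1 c2) Q s \<longleftrightarrow> wp c1 (\<lambda>t. wp c2 (\<lambda>u. Q (t + u))) s"
  unfolding wp_def by (blast intro: runs.Seq elim: SeqE)

lemma wp_Cond [simp]:
  "wp (Cond b c1 c2) Q s \<longleftrightarrow> (if bval b s then wp c1 (\<lambda>t. Q (Suc t)) s else wp c2 (\<lambda>t. Q (Suc t)) s)"
proof -
  have "runs (Cond b c1 c2) s t s' \<longleftrightarrow> (\<exists>u. t = Suc u \<and> runs (if bval b s then c1 else c2) s u s')" for t s'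
  proof
    assume "runs (Cond b c1 c2) s t s'"
    then show "\<exists>u. t = Suc u \<and> runs (if bval b s then c1 else c2) s u s'"
      by (cases rule: runs.cases) auto
  next
    assume "\<exists>u. t = Suc u \<and> runs (if bval b s then c1 else c2) s u s'"
    then show "runs (Cond b c1 c2) s t s'"
      using runs.CondTrue[of b s c1] runs.CondFalse[of b s c2] by (cases "bval b s") auto
  qed
  then show ?thesis by (auto simp: wp_def)
qed

lemma wp_While:
  assumes "Inv s"
    and step: "\<And>s. Inv s \<Longrightarrow> bval b s \<Longrightarrow> wp c (\<lambda>t s'. Inv s' \<and> f s' < f s \<and> t \<le> K) s"
  shows "wp (While b c) (\<lambda>t s'. Inv s' \<and> \<not> bval b s' \<and> t \<le> Suc (f s * Suc K)) s"
  using assms(1)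
proof (induction "f s" arbitrary: s rule: less_induct)
  case less
  show ?case
  proof (cases "bval b s")
    case False
    then show ?thesis using less.prems runs.WhileFalse[OF False] unfolding wp_def by fastforce
  next
    case True
    obtain t s' where 1: "runs c s t s'" "Inv s'" "f s' < f s" "t \<le> K"
      using step[OF less.prems True] by (auto simp: wp_def)
    obtain u s'' where 2: "runs (While b c) s' u s''" "Inv s''" "\<not> bval b s''" "u \<le> Suc (f s' * Suc K)"
      using less.hyps[OF 1(3,2)] by (auto simp: wp_def)
    have "Suc (f s') * Suc K \<le> f s * Suc K" using 1(3) by (intro mult_le_mono1) simp
    then have "1 + t + u \<le> Suc (f s * Suc K)" using 1(4) 2(4) by simp
    then show ?thesis
      using runs.WhileTrue[OF True 1(1) 2(1)] 2 unfolding wp_def by blast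
  qed
qed

notation Seq (infixr ";;" 60)

abbreviation var :: "string \<Rightarrow> aexp" where
  "var x \<equiv> Read x (Const 0)"

abbreviation assign :: "string \<Rightarrow> aexp \<Rightarrow> com" where
  "assign x a \<equiv> Store x (Const 0) a"

abbreviation increment :: "string \<Rightarrow> aexp \<Rightarrow> com" where
  "increment x a \<equiv> Store x a (Plus (Read x a) (Const 1))"

abbreviation decrement :: "string \<Rightarrow> aexp \<Rightarrow> com" where
  "decrement x a \<equiv> Store x a (Minus (Read x a) (Const 1))"

definition offsets :: "nat \<Rightarrow> string \<Rightarrow> string \<Rightarrow> com" where
  "offsets n deg off =
     assign ''i'' (Const 0) ;;
     While (Less (var ''i'') (Read ''count'' (Const n)))
       (Store off (Plus (var ''i'') (Const 1)) (Plus (Read off (var ''i'')) (Read deg (var ''i''))) ;;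
        increment ''i'' (Const 0))"

definition find_cheapest :: com where
  "find_cheapest =
     assign ''b'' (Read ''hpref'' (Read ''hoff'' (var ''i''))) ;;
     assign ''j'' (Const 0) ;;
     While (Less (var ''j'') (Read ''hdegree'' (var ''i'')))
       (assign ''x'' (Read ''hpref'' (Plus (Read ''hoff'' (var ''i'')) (var ''j''))) ;;
        Cond (Less (Read ''price'' (var ''x'')) (Read ''price'' (var ''b'')))
          (assign ''b'' (var ''x'')) Skip ;;
        increment ''j'' (Const 0))"

definition buy :: com where
  "buy =
     find_cheapest ;;
     Cond (Less (Const 0) (Read ''match'' (var ''b'')))
       (decrement ''cnt'' (Minus (Read ''match'' (var ''b'')) (Const 1))) Skip ;;
     Store ''match'' (var ''b'') (Plus (var ''i'') (Const 1)) ;;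
     increment ''cnt'' (var ''i'') ;;
     increment ''price'' (var ''b'') ;;
     assign ''i'' (Const 0)"

definition auction :: com where
  "auction =
     assign ''i'' (Const 0) ;;
     While (Less (var ''i'') (Read ''count'' (Const 1)))
       (Cond (Less (Read ''cnt'' (var ''i'')) (Read ''lquota'' (var ''i'')))
         buy (increment ''i'' (Const 0)))"

definition find_victim :: com where
  "find_victim =
     assign ''b'' (var ''i'') ;;
     assign ''j'' (Const 0) ;;
     While (Less (var ''j'') (Read ''hdegree'' (var ''h'')))
       (assign ''x'' (Read ''hpref'' (Plus (Read ''hoff'' (var ''h'')) (var ''j''))) ;;
        Cond (Conj (Equal (Read ''match'' (var ''x'')) (Plus (var ''h'') (Const 1)))
               (Neg (Conj (Less (Const 0) (Read ''next'' (var ''x'')))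
                 (Equal (Read ''next'' (var ''b'')) (Const 0)))))
          (assign ''b'' (var ''x'')) Skip ;;
        increment ''j'' (Const 0))"

definition propose :: com where
  "propose =
     assign ''h'' (Read ''rpref'' (Plus (Read ''roff'' (var ''i'')) (Read ''next'' (var ''i'')))) ;;
     increment ''next'' (var ''i'') ;;
     Store ''match'' (var ''i'') (Plus (var ''h'') (Const 1)) ;;
     Cond (Less (Read ''cnt'' (var ''h'')) (Read ''uquota'' (var ''h'')))
       (increment ''cnt'' (var ''h''))
       (find_victim ;; Store ''match'' (var ''b'') (Const 0)) ;;
     assign ''i'' (Const 0)"

definition proposals :: com where
  "proposals =
     assign ''i'' (Const 0) ;;
     While (Less (var ''i'') (Read ''count'' (Const 0)))
       (Cond (Conj (Equal (Read ''match'' (var ''i'')) (Const 0))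
               (Less (Read ''next'' (var ''i'')) (Read ''rdegree'' (var ''i''))))
         propose (increment ''i'' (Const 0)))"

definition solver :: com where
  "solver =
     offsets 0 ''rdegree'' ''roff'' ;; offsets 1 ''hdegree'' ''hoff'' ;; auction ;; proposals"

lemma wp_offsets:
  assumes names: "off \<noteq> ''i''" "off \<noteq> ''count''" "off \<noteq> deg" "deg \<noteq> ''i''"
    and s: "s ''count'' n = N" "s off 0 = 0"
  shows "wp (offsets n deg off) (\<lambda>t s'. t \<le> 2 + 3 * N \<and> (\<forall>x. x \<noteq> ''i'' \<longrightarrow> x \<noteq> off \<longrightarrow> s' x = s x) \<and>
    (\<forall>i\<le>N. s' off i = (\<Sum>j<i. s deg j))) s"
proof -
  let ?Inv = "\<lambda>s'. (\<forall>x. x \<noteq> ''i'' \<longrightarrow> x \<noteq> off \<longrightarrow> s' x = s x) \<and> s' ''i'' 0 \<le> N \<and>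
    (\<forall>i\<le>s' ''i'' 0. s' off i = (\<Sum>j<i. s deg j))"
  show ?thesis
    unfolding offsets_def wp_Seq
    using names s
    by (simp, intro wp_mono[OF wp_While[where Inv = ?Inv and f = "\<lambda>s. N - s ''i'' 0" and K = 2]])
      (auto simp: le_Suc_eq)
qed

lemma array_of_concat:
  assumes "i < n" "j < length (f i)"
  shows "array_of_list (concat (map f [0..<n])) ((\<Sum>l<i. length (f l)) + j) = f i ! j"
proof -
  have len: "length (concat (map f [0..<n])) = (\<Sum>l<n. length (f l))" for n
    by (induction n) auto
  have "(\<Sum>l<i. length (f l)) + j < (\<Sum>l<n. length (f l)) \<and>
      concat (map f [0..<n]) ! ((\<Sum>l<i. length (f l)) + j) = f i ! j"
    using assms(1)
  proof (induction n)
    case (Suc n)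
    then show ?case
      using assms(2) len[of n] by (cases "i = n") (auto simp: nth_append)
  qed simp
  then show ?thesis by (simp add: array_of_list_def len)
qed

definition decode :: "nat \<Rightarrow> nat option" where
  "decode n = (case n of 0 \<Rightarrow> None | Suc h \<Rightarrow> Some h)"

lemma decode_simps [simp]:
  "decode 0 = None" "decode (Suc h) = Some h"
  "decode n = None \<longleftrightarrow> n = 0" "decode n = Some h \<longleftrightarrow> n = Suc h"
  by (auto simp: decode_def split: nat.splits)

locale numbered_hrlq =
  fixes I :: "(nat, nat) hrlq"
  assumes numbered: "numbered_instance I"
begin

sublocale hrlq I
  using numbered by unfold_locales (simp add: numbered_instance_def)

definition R where "R = card (residents I)"
definition H where "H = card (hospitals I)"

lemma residents_eq: "residents I = {..<R}" and hospitals_eq: "hospitals I = {..<H}"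
  using numbered by (auto simp: numbered_instance_def R_def H_def)

lemma R_le: "R \<le> instance_size I" and H_le: "H \<le> instance_size I"
  by (auto simp: instance_size_def R_def H_def)

lemma length_hpref_le:
  assumes "h < H"
  shows "length (hpref I h) \<le> instance_size I"
proof -
  have h: "h \<in> hospitals I" using assms hospitals_eq by simp
  have "length (hpref I h) = card (set (hpref I h))" using distinct_hpref[OF h] by (simp add: distinct_card)
  also have "\<dots> = card ((\<lambda>r. (r, h)) ` set (hpref I h))" by (intro card_image[symmetric]) (auto simp: inj_on_def)
  also have "\<dots> \<le> card (edges I)" using set_hpref[OF h] by (intro card_mono) auto
  finally show ?thesis by (simp add: instance_size_def)
qed

lemma length_rpref_le:
  assumes "r < R"
  shows "length (rpref I r) \<le> instance_size I"
proof -
  have r: "r \<in> residents I" using assms residents_eq by simp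
  have "length (rpref I r) = card (set (rpref I r))" using distinct_rpref[OF r] by (simp add: distinct_card)
  also have "\<dots> = card ((\<lambda>h. (r, h)) ` set (rpref I r))" by (intro card_image[symmetric]) (auto simp: inj_on_def)
  also have "\<dots> \<le> card (edges I)" using set_rpref[OF r] by (intro card_mono) auto
  finally show ?thesis by (simp add: instance_size_def)
qed

definition holds_instance :: "memory \<Rightarrow> bool" where
  "holds_instance s \<longleftrightarrow>
     s ''count'' 0 = R \<and> s ''count'' (Suc 0) = H \<and>
     (\<forall>r<R. s ''rdegree'' r = length (rpref I r) \<and>
        (\<forall>j<length (rpref I r). s ''rpref'' (s ''roff'' r + j) = rpref I r ! j)) \<and>
     (\<forall>h<H. s ''lquota'' h = lquota I h \<and> s ''uquota'' h = uquota I h \<and>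
        s ''hdegree'' h = length (hpref I h) \<and>
        (\<forall>j<length (hpref I h). s ''hpref'' (s ''hoff'' h + j) = hpref I h ! j))"

lemma holds_instance_cong:
  assumes "\<And>x. x \<in> {''count'', ''rdegree'', ''rpref'', ''roff'', ''lquota'', ''uquota'', ''hdegree'', ''hpref'', ''hoff''} \<Longrightarrow> s' x = s x"
  shows "holds_instance s' \<longleftrightarrow> holds_instance s"
  unfolding holds_instance_def by (simp add: assms)

lemma holds_instance_upd [simp]:
  assumes "x \<notin> {''count'', ''rdegree'', ''rpref'', ''roff'', ''lquota'', ''uquota'', ''hdegree'', ''hpref'', ''hoff''}"
  shows "holds_instance (s(x := a)) \<longleftrightarrow> holds_instance s"
  by (rule holds_instance_cong) (use assms in auto)

lemma wp_find_cheapest: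
  assumes s: "holds_instance s" "s ''i'' 0 < H" and ne: "hpref I (s ''i'' 0) \<noteq> []"
  shows "wp find_cheapest (\<lambda>t s'. t \<le> 3 + 5 * instance_size I \<and>
    (\<forall>x. x \<notin> {''b'', ''j'', ''x''} \<longrightarrow> s' x = s x) \<and> s' ''b'' 0 \<in> set (hpref I (s ''i'' 0)) \<and>
    (\<forall>r\<in>set (hpref I (s ''i'' 0)). s ''price'' (s' ''b'' 0) \<le> s ''price'' r)) s"
proof -
  define h where "h = s ''i'' 0"
  let ?xs = "hpref I h"
  have h: "h < H" and ne': "?xs \<noteq> []" using s ne by (auto simp: h_def)
  have deg: "s ''hdegree'' h = length ?xs"
    and nth: "\<And>j. j < length ?xs \<Longrightarrow> s ''hpref'' (s ''hoff'' h + j) = ?xs ! j"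
    using s h by (auto simp: holds_instance_def)
  have nth0: "s ''hpref'' (s ''hoff'' h) = ?xs ! 0" using nth[of 0] ne' by simp
  let ?Inv = "\<lambda>s'. (\<forall>x. x \<notin> {''b'', ''j'', ''x''} \<longrightarrow> s' x = s x) \<and> s' ''j'' 0 \<le> length ?xs \<and>
    s' ''b'' 0 \<in> set ?xs \<and> (\<forall>j < s' ''j'' 0. s ''price'' (s' ''b'' 0) \<le> s ''price'' (?xs ! j))"
  have *: "wp (While (Less (var ''j'') (Read ''hdegree'' (var ''i'')))
       (assign ''x'' (Read ''hpref'' (Plus (Read ''hoff'' (var ''i'')) (var ''j''))) ;;
        Cond (Less (Read ''price'' (var ''x'')) (Read ''price'' (var ''b'')))
          (assign ''b'' (var ''x'')) Skip ;;
        increment ''j'' (Const 0)))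
      (\<lambda>t s'. ?Inv s' \<and> \<not> bval (Less (var ''j'') (Read ''hdegree'' (var ''i''))) s' \<and>
        t \<le> Suc ((length ?xs - s0 ''j'' 0) * Suc 4)) s0"
    (is "wp (While _ ?body) _ _") if "?Inv s0" for s0
  proof (rule wp_While[where f = "\<lambda>s. length ?xs - s ''j'' 0"])
    fix s' assume inv: "?Inv s'" and b: "bval (Less (var ''j'') (Read ''hdegree'' (var ''i''))) s'"
    show "wp ?body
        (\<lambda>t s''. ?Inv s'' \<and> length ?xs - s'' ''j'' 0 < length ?xs - s' ''j'' 0 \<and> t \<le> 4) s'"
    proof -
      have same: "\<And>x. x \<notin> {''b'', ''j'', ''x''} \<Longrightarrow> s' x = s x" using inv by blast
      have eqs: "s' ''i'' = s ''i''" "s' ''hpref'' = s ''hpref''" "s' ''hoff'' = s ''hoff''"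
        "s' ''price'' = s ''price''" "s' ''hdegree'' = s ''hdegree''"
        by (rule same, simp)+
      have j: "s' ''j'' 0 < length ?xs" using b deg by (simp add: eqs h_def[symmetric])
      show ?thesis
      proof (cases "s ''price'' (?xs ! s' ''j'' 0) < s ''price'' (s' ''b'' 0)")
        case True
        have "s ''price'' (?xs ! s' ''j'' 0) \<le> s ''price'' (?xs ! j)" if "j < Suc (s' ''j'' 0)" for j
          using inv that True by (cases "j = s' ''j'' 0") (force simp: less_Suc_eq)+
        then show ?thesis
          using True j same by (simp add: eqs h_def[symmetric] nth)
      next
        case False
        have "s ''price'' (s' ''b'' 0) \<le> s ''price'' (?xs ! j)" if "j < Suc (s' ''j'' 0)" for j
          using inv that False by (cases "j = s' ''j'' 0") (force simp: less_Suc_eq)+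
        then show ?thesis
          using False j same inv by (simp add: eqs h_def[symmetric] nth)
      qed
    qed
  qed (use that in blast)
  have len: "length ?xs \<le> instance_size I" using length_hpref_le[OF h] .
  show ?thesis
    unfolding find_cheapest_def wp_Seq wp_Store
  proof (rule wp_mono[OF *], goal_cases)
    case 1
    show ?case using ne' by (simp add: h_def[symmetric] nth0)
  next
    case (2 t s')
    then have eqs: "s' ''i'' = s ''i''" "s' ''hdegree'' = s ''hdegree''" by simp_all
    then have "length ?xs \<le> s' ''j'' 0" using 2 deg by (simp add: eqs h_def[symmetric])
    then show ?case
      using 2 len by (simp add: h_def[symmetric] all_set_conv_all_nth)
  qed
qed

definition assignment :: "memory \<Rightarrow> nat \<Rightarrow> nat option" where
  "assignment s = decode \<circ> s ''match''"

lemma assignment_upd: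
  "x \<noteq> ''match'' \<Longrightarrow> assignment (s(x := a)) = assignment s"
  by (simp add: assignment_def)

lemma assignment_cong: "s' ''match'' = s ''match'' \<Longrightarrow> assignment s' = assignment s"
  by (simp add: assignment_def)

lemma in_occupants: "r \<in> occupants (assignment s) h \<longleftrightarrow> r < R \<and> s ''match'' r = Suc h"
  by (auto simp: occupants_def assignment_def residents_eq)

lemma output_matching_eq: "output_matching I s = graph (assignment s)"
  by (auto simp: output_matching_def graph_def assignment_def)

definition counts_ok :: "memory \<Rightarrow> bool" where
  "counts_ok s \<longleftrightarrow> (\<forall>h<H. s ''cnt'' h = card (occupants (assignment s) h))"

definition auction_ok :: "memory \<Rightarrow> bool" where
  "auction_ok s \<longleftrightarrow> holds_instance s \<and> counts_ok s \<and> s ''next'' = (\<lambda>_. 0) \<and>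
     auction_inv (assignment s) (s ''price'') \<and>
     s ''i'' 0 \<le> H \<and> (\<forall>h < s ''i'' 0. lquota I h \<le> s ''cnt'' h)"

definition auction_measure :: "memory \<Rightarrow> nat" where
  "auction_measure s = (R * Suc R - (\<Sum>r<R. s ''price'' r)) * Suc H + (H - s ''i'' 0)"

lemma occupants_reassign:
  assumes "b \<in> residents I"
  shows "occupants (m(b := Some h)) h' = (if h' = h then insert b (occupants m h) else occupants m h' - {b})"
  using assms by (auto simp: occupants_def)

lemma card_occupants_reassign:
  assumes "b \<in> residents I"
  shows "card (occupants (m(b := Some h)) h') =
    card (occupants m h') - (if m b = Some h' then 1 else 0) + (if h' = h then 1 else 0)"
proof -
  have "b \<in> occupants m h' \<longleftrightarrow> m b = Some h'" using assms by (simp add: occupants_def)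
  moreover have "b \<in> occupants m h' \<Longrightarrow> 0 < card (occupants m h')" by (auto simp: card_gt_0_iff)
  ultimately show ?thesis
    unfolding occupants_reassign[OF assms] by (auto simp: card_insert_if card_Diff_singleton_if)
qed

lemma auction_round:
  assumes feas: "feasible_matching I N" and s: "auction_ok s" "s ''i'' 0 < H"
    and deficit: "s ''cnt'' (s ''i'' 0) < lquota I (s ''i'' 0)"
  shows "wp buy
    (\<lambda>t s'. auction_ok s' \<and> auction_measure s' < auction_measure s \<and> t \<le> 9 + 5 * instance_size I) s"
proof -
  define h where "h = s ''i'' 0"
  have h: "h < H" "h \<in> hospitals I" using s by (auto simp: h_def hospitals_eq)
  have inv: "auction_inv (assignment s) (s ''price'')" and hold: "holds_instance s"
    and cnt: "\<And>h. h < H \<Longrightarrow> s ''cnt'' h = card (occupants (assignment s) h)"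
    and nxt: "s ''next'' = (\<lambda>_. 0)"
    using s by (auto simp: auction_ok_def counts_ok_def)
  have deficit': "card (occupants (assignment s) h) < lquota I h"
    using deficit cnt[OF h(1)] by (simp add: h_def)
  obtain r0 where r0: "(r0, h) \<in> edges I" "s ''price'' r0 \<le> R"
    using cheap_neighbour_exists[OF inv feas h(2) deficit'] by (auto simp: R_def)
  have set: "r \<in> set (hpref I h) \<longleftrightarrow> (r, h) \<in> edges I" for r using set_hpref[OF h(2)] .
  then have ne: "hpref I h \<noteq> []" using r0 by force
  show ?thesis
    unfolding buy_def wp_Seq[of find_cheapest]
  proof (rule wp_mono[OF wp_find_cheapest])
    fix t s'
    assume "t \<le> 3 + 5 * instance_size I \<and>
      (\<forall>x. x \<notin> {''b'', ''j'', ''x''} \<longrightarrow> s' x = s x) \<and> s' ''b'' 0 \<in> set (hpref I (s ''i'' 0)) \<and>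
      (\<forall>r\<in>set (hpref I (s ''i'' 0)). s ''price'' (s' ''b'' 0) \<le> s ''price'' r)"
    then have t: "t \<le> 3 + 5 * instance_size I"
      and same: "\<And>x. x \<notin> {''b'', ''j'', ''x''} \<Longrightarrow> s' x = s x"
      and b_edge: "(s' ''b'' 0, h) \<in> edges I"
      and b_min: "\<And>r. (r, h) \<in> edges I \<Longrightarrow> s ''price'' (s' ''b'' 0) \<le> s ''price'' r"
      using set by (auto simp: h_def)
    define b where "b = s' ''b'' 0"
    have eqs: "s' ''i'' = s ''i''" "s' ''match'' = s ''match''" "s' ''cnt'' = s ''cnt''"
      "s' ''price'' = s ''price''" "s' ''next'' = s ''next''"
      by (rule same, simp)+
    have as: "assignment s' = assignment s" by (rule assignment_cong) (rule eqs)
    have hold': "holds_instance s'" using hold by (subst holds_instance_cong[of _ s]) (auto intro: same)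
    have b: "b \<in> residents I" "b < R" using edgeD[OF b_edge] by (auto simp: b_def residents_eq)
    have pb: "s ''price'' b \<le> R" using b_min[OF r0(1)] r0(2) by (simp add: b_def)
    have inv': "auction_inv ((assignment s)(b := Some h)) ((s ''price'')(b := Suc (s ''price'' b)))"
      using auction_step[OF inv h(2) deficit', of b] b_edge b_min pb by (simp add: b_def R_def)
    have cards: "card (occupants ((assignment s)(b := Some h)) h') =
      s ''cnt'' h' - (if s ''match'' b = Suc h' then 1 else 0) + (if h' = h then 1 else 0)" if "h' < H" for h'
      using card_occupants_reassign[OF b(1), of "assignment s" h h'] cnt[OF that]
      by (simp add: assignment_def)
    let ?p = "(s ''price'')(b := Suc (s ''price'' b))"
    have "(\<Sum>r<R. ?p r) \<le> (\<Sum>r<R. Suc R)"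
      using inv' by (intro sum_mono) (auto simp: auction_inv_def residents_eq)
    then have bound: "(\<Sum>r<R. ?p r) \<le> R * Suc R" by simp
    have "(\<Sum>r<R. ?p r) = (\<Sum>r<R. s ''price'' r + (if r = b then 1 else 0))"
      by (intro sum.cong) auto
    also have "\<dots> = Suc (\<Sum>r<R. s ''price'' r)"
      using b by (simp add: sum.distrib)
    finally have "Suc (R * Suc R - (\<Sum>r<R. ?p r)) = R * Suc R - (\<Sum>r<R. s ''price'' r)"
      using bound by simp
    then have "(R * Suc R - (\<Sum>r<R. s ''price'' r)) * Suc H = Suc H + (R * Suc R - (\<Sum>r<R. ?p r)) * Suc H"
      by (metis mult_Suc)
    then have decr: "(R * Suc R - (\<Sum>r<R. ?p r)) * Suc H + H < auction_measure s"
      unfolding auction_measure_def by linarith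
    let ?s = "\<lambda>c. s'(''cnt'' := c, ''match'' := (s ''match'')(b := Suc h), ''cnt'' := c(h := Suc (c h)),
      ''price'' := ?p, ''i'' := (s ''i'')(0 := 0))"
    have ok: "auction_ok (?s c) \<and> auction_measure (?s c) < auction_measure s"
      if c: "\<And>h'. h' < H \<Longrightarrow> c h' = s ''cnt'' h' - (if s ''match'' b = Suc h' then 1 else 0)" for c
    proof -
      have "assignment (?s c) = (assignment s)(b := Some h)"
        by (auto simp: assignment_def)
      then have "auction_ok (?s c)"
        using inv' hold' nxt cards c h by (auto simp: auction_ok_def counts_ok_def eqs)
      moreover have "auction_measure (?s c) = (R * Suc R - (\<Sum>r<R. ?p r)) * Suc H + H"
        by (simp add: auction_measure_def)
      ultimately show ?thesis using decr by simp
    qed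
    show "wp (Cond (Less (Const 0) (Read ''match'' (var ''b'')))
            (decrement ''cnt'' (Minus (Read ''match'' (var ''b'')) (Const 1))) Skip ;;
          Store ''match'' (var ''b'') (Plus (var ''i'') (Const 1)) ;;
          increment ''cnt'' (var ''i'') ;;
          increment ''price'' (var ''b'') ;;
          assign ''i'' (Const 0))
       (\<lambda>u s''. auction_ok s'' \<and> auction_measure s'' < auction_measure s \<and> t + u \<le> 9 + 5 * instance_size I) s'"
    proof (cases "s ''match'' b")
      case 0
      then show ?thesis using ok[of "s ''cnt''"] t
        by (simp add: eqs b_def[symmetric] h_def[symmetric])
    next
      case (Suc h')
      then show ?thesis using ok[of "(s ''cnt'')(h' := s ''cnt'' h' - 1)"] t
        by (simp add: eqs b_def[symmetric] h_def[symmetric])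
    qed
  qed (use hold s ne in \<open>auto simp: h_def\<close>)
qed

lemma wp_auction:
  assumes feas: "feasible_matching I N"
    and s: "holds_instance s" "s ''next'' = (\<lambda>_. 0)" "s ''match'' = (\<lambda>_. 0)" "s ''cnt'' = (\<lambda>_. 0)"
      "s ''price'' = (\<lambda>_. 0)"
  shows "wp auction (\<lambda>t s'. auction_ok s' \<and> H \<le> s' ''i'' 0 \<and>
    t \<le> 2 + (R * Suc R * Suc H + H) * (11 + 5 * instance_size I)) s"
proof -
  let ?s = "s(''i'' := (s ''i'')(0 := 0))"
  have "occupants (assignment s) h = {}" for h using s by (auto simp: in_occupants)
  then have init: "auction_ok ?s"
    using s by (auto simp: auction_ok_def counts_ok_def assignment_upd auction_inv_def assignment_def)
  have meas: "auction_measure ?s = R * Suc R * Suc H + H"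
    using s by (simp add: auction_measure_def)
  show ?thesis
    unfolding auction_def wp_Seq[of "assign ''i'' (Const 0)"] wp_Store
  proof (rule wp_mono[OF wp_While[where Inv = auction_ok and f = auction_measure and K = "10 + 5 * instance_size I"]])
    show "auction_ok (s(''i'' := (s ''i'')(aval (Const 0) s := aval (Const 0) s)))" using init by simp
  next
    fix s assume ok: "auction_ok s" and b: "bval (Less (var ''i'') (Read ''count'' (Const 1))) s"
    then have i: "s ''i'' 0 < H" and lq: "s ''lquota'' (s ''i'' 0) = lquota I (s ''i'' 0)"
      by (auto simp: auction_ok_def holds_instance_def)
    show "wp (Cond (Less (Read ''cnt'' (var ''i'')) (Read ''lquota'' (var ''i'')))
         buy (increment ''i'' (Const 0)))
       (\<lambda>t s'. auction_ok s' \<and> auction_measure s' < auction_measure s \<and> t \<le> 10 + 5 * instance_size I) s"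
    proof (cases "s ''cnt'' (s ''i'' 0) < lquota I (s ''i'' 0)")
      case True
      have "wp buy (\<lambda>t s'. auction_ok s' \<and> auction_measure s' < auction_measure s \<and> Suc t \<le> 10 + 5 * instance_size I) s"
        by (rule wp_mono[OF auction_round[OF feas ok i True]]) simp
      then show ?thesis
        by (simp only: wp_Cond bval.simps aval.simps lq True if_True)
    next
      case False
      then show ?thesis using ok i lq
        by (auto simp: auction_ok_def auction_measure_def counts_ok_def assignment_upd less_Suc_eq)
    qed
  next
    fix t s'
    assume "auction_ok s' \<and> \<not> bval (Less (var ''i'') (Read ''count'' (Const 1))) s' \<and>
      t \<le> Suc (auction_measure (s(''i'' := (s ''i'')(aval (Const 0) s := aval (Const 0) s))) *
        Suc (10 + 5 * instance_size I))"
    then show "auction_ok s' \<and> H \<le> s' ''i'' 0 \<and>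
      1 + t \<le> 2 + (R * Suc R * Suc H + H) * (11 + 5 * instance_size I)"
      using meas by (auto simp: auction_ok_def holds_instance_def)
  qed
qed

lemma wp_find_victim:
  fixes s
  defines "h \<equiv> s ''h'' 0" and "A \<equiv> occupants (assignment s) (s ''h'' 0)" and "k \<equiv> s ''next''"
  assumes s: "holds_instance s" "h < H" "s ''i'' 0 \<in> A" and edge: "\<And>r. r \<in> A \<Longrightarrow> (r, h) \<in> edges I"
  shows "wp find_victim (\<lambda>t s'. t \<le> 3 + 5 * instance_size I \<and>
    (\<forall>x. x \<notin> {''b'', ''j'', ''x''} \<longrightarrow> s' x = s x) \<and> s' ''b'' 0 \<in> A \<and>
    (k (s' ''b'' 0) = 0 \<or>
      (\<forall>x\<in>A. k x \<noteq> 0 \<and> (x = s' ''b'' 0 \<or> precedes (hpref I h) x (s' ''b'' 0))))) s"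
proof -
  let ?xs = "hpref I h"
  have deg: "s ''hdegree'' h = length ?xs"
    and nth: "\<And>j. j < length ?xs \<Longrightarrow> s ''hpref'' (s ''hoff'' h + j) = ?xs ! j"
    using s by (auto simp: holds_instance_def)
  have h: "h \<in> hospitals I" using s by (simp add: hospitals_eq)
  have set: "r \<in> set ?xs \<longleftrightarrow> (r, h) \<in> edges I" for r using set_hpref[OF h] .
  have inA: "?xs ! j \<in> A \<longleftrightarrow> s ''match'' (?xs ! j) = Suc h" if "j < length ?xs" for j
    using that set[of "?xs ! j"] edgeD[of "?xs ! j" h]
    by (auto simp: A_def in_occupants residents_eq h_def)
  let ?good = "\<lambda>n b. b \<in> A \<and> (k b = 0 \<or>
      (\<forall>j<n. ?xs ! j \<in> A \<longrightarrow> k (?xs ! j) \<noteq> 0 \<and> (?xs ! j = b \<or> precedes ?xs (?xs ! j) b)))"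
  let ?Inv = "\<lambda>s'. (\<forall>x. x \<notin> {''b'', ''j'', ''x''} \<longrightarrow> s' x = s x) \<and> s' ''j'' 0 \<le> length ?xs \<and>
    ?good (s' ''j'' 0) (s' ''b'' 0)"
  have *: "wp (While (Less (var ''j'') (Read ''hdegree'' (var ''h'')))
       (assign ''x'' (Read ''hpref'' (Plus (Read ''hoff'' (var ''h'')) (var ''j''))) ;;
        Cond (Conj (Equal (Read ''match'' (var ''x'')) (Plus (var ''h'') (Const 1)))
               (Neg (Conj (Less (Const 0) (Read ''next'' (var ''x'')))
                 (Equal (Read ''next'' (var ''b'')) (Const 0)))))
          (assign ''b'' (var ''x'')) Skip ;;
        increment ''j'' (Const 0)))
      (\<lambda>t s'. ?Inv s' \<and> \<not> bval (Less (var ''j'') (Read ''hdegree'' (var ''h''))) s' \<and>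
        t \<le> Suc ((length ?xs - s0 ''j'' 0) * Suc 4)) s0"
    (is "wp (While _ ?body) _ _") if "?Inv s0" for s0
  proof (rule wp_While[where f = "\<lambda>s. length ?xs - s ''j'' 0"])
    fix s' assume inv: "?Inv s'" and b: "bval (Less (var ''j'') (Read ''hdegree'' (var ''h''))) s'"
    have same: "\<And>x. x \<notin> {''b'', ''j'', ''x''} \<Longrightarrow> s' x = s x" using inv by blast
    have eqs: "s' ''h'' = s ''h''" "s' ''hpref'' = s ''hpref''" "s' ''hoff'' = s ''hoff''"
      "s' ''match'' = s ''match''" "s' ''next'' = s ''next''" "s' ''hdegree'' = s ''hdegree''"
      by (rule same, simp)+
    define n where "n = s' ''j'' 0"
    define b' where "b' = s' ''b'' 0"
    have n: "n < length ?xs" using b deg by (simp add: eqs h_def[symmetric] n_def)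
    have good: "?good n b'" using inv by (simp add: n_def b'_def)
    show "wp ?body
        (\<lambda>t s''. ?Inv s'' \<and> length ?xs - s'' ''j'' 0 < length ?xs - s' ''j'' 0 \<and> t \<le> 4) s'"
    proof (cases "?xs ! n \<in> A \<and> (k (?xs ! n) = 0 \<or> k b' \<noteq> 0)")
      case True
      have "precedes ?xs (?xs ! j) (?xs ! n)" if "j < n" for j
        using that n precedes_nth[OF distinct_hpref[OF h], of j n] by simp
      then have "?good (Suc n) (?xs ! n)"
        using good True by (auto simp: less_Suc_eq)
      then show ?thesis
        using True n same inA[OF n]
        by (simp add: eqs h_def[symmetric] nth n_def[symmetric] b'_def[symmetric] k_def[symmetric])
    next
      case False
      then have "?good (Suc n) b'"
        using good by (auto simp: less_Suc_eq)
      moreover have "s ''match'' (?xs ! n) \<noteq> Suc h \<or> 0 < k (?xs ! n) \<and> k b' = 0"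
        using False inA[OF n] by auto
      ultimately show ?thesis
        using n same
        by (elim disjE) (simp_all add: eqs h_def[symmetric] nth n_def[symmetric] b'_def[symmetric] k_def[symmetric])
    qed
  qed (use that in blast)
  have len: "length ?xs \<le> instance_size I" using length_hpref_le s by simp
  show ?thesis
    unfolding find_victim_def wp_Seq wp_Store
  proof (rule wp_mono[OF *], goal_cases)
    case 1
    show ?case using s by simp
  next
    case (2 t s')
    then have eqs: "s' ''h'' = s ''h''" "s' ''hdegree'' = s ''hdegree''" by simp_all
    then have j: "length ?xs \<le> s' ''j'' 0" using 2 deg by (simp add: eqs h_def[symmetric])
    have "A \<subseteq> set ?xs" using edge set by blast
    then have "\<exists>j < s' ''j'' 0. x = ?xs ! j" if "x \<in> A" for x
      using that j by (metis in_set_conv_nth order.strict_trans2 subsetD)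
    then have "k (s' ''b'' 0) = 0 \<or>
      (\<forall>x\<in>A. k x \<noteq> 0 \<and> (x = s' ''b'' 0 \<or> precedes (hpref I h) x (s' ''b'' 0)))"
      using 2 by metis
    then show ?case using 2 len by simp
  qed
qed

definition proposals_ok :: "memory \<Rightarrow> bool" where
  "proposals_ok s \<longleftrightarrow> holds_instance s \<and> counts_ok s \<and> proposal_inv (assignment s) (s ''next'') \<and>
     s ''i'' 0 \<le> R \<and> (\<forall>r < s ''i'' 0. s ''match'' r = 0 \<longrightarrow> length (rpref I r) \<le> s ''next'' r)"

definition proposals_measure :: "memory \<Rightarrow> nat" where
  "proposals_measure s = (\<Sum>r<R. length (rpref I r) - s ''next'' r) * Suc R + (R - s ''i'' 0)"

lemma proposal_round:
  assumes s: "proposals_ok s" "s ''i'' 0 < R" "s ''match'' (s ''i'' 0) = 0"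
    and more: "s ''next'' (s ''i'' 0) < length (rpref I (s ''i'' 0))"
  shows "wp propose
    (\<lambda>t s'. proposals_ok s' \<and> proposals_measure s' < proposals_measure s \<and> t \<le> 9 + 5 * instance_size I) s"
proof -
  define r where "r = s ''i'' 0"
  define m where "m = assignment s"
  define k where "k = s ''next''"
  define h where "h = rpref I r ! k r"
  have inv: "proposal_inv m k" and hold: "holds_instance s"
    and cnt: "\<And>h. h < H \<Longrightarrow> s ''cnt'' h = card (occupants m h)"
    using s by (auto simp: proposals_ok_def counts_ok_def m_def k_def)
  have r: "r < R" "r \<in> residents I" "m r = None" "k r < length (rpref I r)"
    using s more by (auto simp: r_def m_def k_def residents_eq assignment_def)
  have hv: "s ''rpref'' (s ''roff'' r + k r) = h"
    using hold r by (simp add: holds_instance_def h_def)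
  have e: "(r, h) \<in> edges I" unfolding h_def using r by (intro rpref_nth_edge)
  then have h: "h < H" "h \<in> hospitals I" using edgeD by (auto simp: hospitals_eq)
  have uq: "s ''uquota'' h = uquota I h" using hold h by (simp add: holds_instance_def)
  define k' where "k' = k(r := Suc (k r))"
  define m' where "m' = m(r := Some h)"
  define s1 where "s1 = s(''h'' := (s ''h'')(0 := h), ''next'' := k', ''match'' := (s ''match'')(r := Suc h))"
  have as1: "assignment s1 = m'" by (auto simp: s1_def m'_def m_def assignment_def)
  have hold1: "holds_instance s1" using hold by (simp add: s1_def)
  have "(\<Sum>q<R. length (rpref I q) - k' q) < (\<Sum>q<R. length (rpref I q) - k q)"
    using r by (intro sum_strict_mono_ex1) (auto simp: k'_def)
  then have "Suc (\<Sum>q<R. length (rpref I q) - k' q) * Suc R \<le> (\<Sum>q<R. length (rpref I q) - k q) * Suc R"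
    by (intro mult_le_mono1) simp
  then have decr: "(\<Sum>q<R. length (rpref I q) - k' q) * Suc R + R < proposals_measure s"
    unfolding proposals_measure_def k_def by simp
  have occ': "occupants m' h' = (if h' = h then insert r (occupants m h') else occupants m h')" for h'
    unfolding m'_def by (rule occupants_assign) (use r in auto)
  have r_notin: "r \<notin> occupants m h'" for h' using r by (simp add: not_in_occupants)
  have ok: "proposals_ok s' \<and> proposals_measure s' < proposals_measure s"
    if "holds_instance s'" "proposal_inv (assignment s') k'" "s' ''next'' = k'" "s' ''i'' 0 = 0" "counts_ok s'" for s'
    using that decr by (simp add: proposals_ok_def proposals_measure_def)
  show ?thesis
  proof (cases "card (occupants m h) < uquota I h")
    case True
    define s2 where "s2 = s1(''cnt'' := (s ''cnt'')(h := Suc (s ''cnt'' h)), ''i'' := (s ''i'')(0 := 0))"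
    have as2: "assignment s2 = m'" using as1 by (simp add: s2_def assignment_def)
    have "proposals_ok s2 \<and> proposals_measure s2 < proposals_measure s"
    proof (rule ok)
      show "proposal_inv (assignment s2) k'"
        using proposal_accept[OF inv r(2-4)] True by (simp add: as2 h_def m'_def k'_def)
      show "counts_ok s2"
        using cnt r_notin by (auto simp: counts_ok_def as2 occ') (auto simp: s2_def s1_def)
    qed (use hold1 in \<open>simp_all add: s2_def s1_def\<close>)
    then show ?thesis
      unfolding propose_def using True cnt[OF h(1)]
      by (simp add: r_def[symmetric] k_def[symmetric] hv k'_def[symmetric] uq s2_def s1_def)
  next
    case False
    have full: "\<not> s ''cnt'' h < s ''uquota'' h" using False cnt[OF h(1)] uq by simp
    have s1_simps: "s1 ''h'' 0 = h" "s1 ''next'' = k'" "s1 ''i'' 0 = r"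
      "s1 ''cnt'' = s ''cnt''" "s1 ''uquota'' = s ''uquota''"
      by (simp_all add: s1_def r_def)
    have vict: "wp find_victim (\<lambda>t s'. t \<le> 3 + 5 * instance_size I \<and>
      (\<forall>x. x \<notin> {''b'', ''j'', ''x''} \<longrightarrow> s' x = s1 x) \<and> s' ''b'' 0 \<in> occupants m' h \<and>
      (k' (s' ''b'' 0) = 0 \<or> (\<forall>x\<in>occupants m' h.
         k' x \<noteq> 0 \<and> (x = s' ''b'' 0 \<or> precedes (hpref I h) x (s' ''b'' 0))))) s1"
    proof (rule wp_find_victim[of s1, unfolded s1_simps as1, OF hold1 h(1)])
      show "r \<in> occupants m' h" by (simp add: occ')
      show "(q, h) \<in> edges I" if "q \<in> occupants m' h" for q
        using that e proposal_inv_edge[OF inv] by (auto simp: occupants_def m'_def split: if_splits)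
    qed
    have "wp find_victim (\<lambda>t. wp (Store ''match'' (var ''b'') (Const 0)) (\<lambda>u. wp (assign ''i'' (Const 0))
      (\<lambda>w s'. proposals_ok s' \<and> proposals_measure s' < proposals_measure s \<and>
        t + u + w \<le> 5 + 5 * instance_size I))) s1"
    proof (rule wp_mono[OF vict])
      fix t s'
      assume "t \<le> 3 + 5 * instance_size I \<and>
        (\<forall>x. x \<notin> {''b'', ''j'', ''x''} \<longrightarrow> s' x = s1 x) \<and> s' ''b'' 0 \<in> occupants m' h \<and>
        (k' (s' ''b'' 0) = 0 \<or> (\<forall>x\<in>occupants m' h.
          k' x \<noteq> 0 \<and> (x = s' ''b'' 0 \<or> precedes (hpref I h) x (s' ''b'' 0))))"
      then have t: "t \<le> 3 + 5 * instance_size I"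
        and same: "\<And>x. x \<notin> {''b'', ''j'', ''x''} \<Longrightarrow> s' x = s1 x"
        and v: "s' ''b'' 0 \<in> occupants m' h"
        and worst: "k' (s' ''b'' 0) = 0 \<or> (\<forall>x\<in>occupants m' h.
          k' x \<noteq> 0 \<and> (x = s' ''b'' 0 \<or> precedes (hpref I h) x (s' ''b'' 0)))"
        by blast+
      define v where "v = s' ''b'' 0"
      have eqs: "s' ''match'' = s1 ''match''" "s' ''next'' = k'" "s' ''cnt'' = s ''cnt''"
        "s' ''i'' = s ''i''"
        using same[of "''match''"] same[of "''next''"] same[of "''cnt''"] same[of "''i''"]
        by (simp_all add: s1_def)
      define s2 where "s2 = s'(''match'' := (s1 ''match'')(v := 0), ''i'' := (s ''i'')(0 := 0))"
      have as2: "assignment s2 = m'(v := None)"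
        by (auto simp: s2_def assignment_def as1[symmetric])
      have "proposals_ok s2 \<and> proposals_measure s2 < proposals_measure s"
      proof (rule ok)
        show "holds_instance s2"
          using hold1 unfolding s2_def by (simp, subst holds_instance_cong[of _ s1]) (auto intro: same)
        show "proposal_inv (assignment s2) k'"
          unfolding as2 m'_def k'_def h_def
          by (rule proposal_replace[OF inv r(2-4)])
            (use False v worst in \<open>simp_all add: v_def m'_def k'_def h_def\<close>)
        have "card (occupants (m'(v := None)) h') = card (occupants m h')" for h'
        proof (cases "h' = h")
          case True
          then show ?thesis using v r_notin
            by (auto simp: occupants_release occ' v_def card_Diff_singleton_if)
        next
          case False
          then have "v \<notin> occupants m' h'" using v by (auto simp: occupants_def v_def)
          then show ?thesis using False by (simp add: occupants_release occ')
        qed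
        then show "counts_ok s2"
          using cnt unfolding counts_ok_def as2 by (simp add: s2_def eqs)
      qed (simp_all add: s2_def eqs)
      then show "wp (Store ''match'' (var ''b'') (Const 0)) (\<lambda>u. wp (assign ''i'' (Const 0))
        (\<lambda>w s'. proposals_ok s' \<and> proposals_measure s' < proposals_measure s \<and>
          t + u + w \<le> 5 + 5 * instance_size I)) s'"
        using t by (simp add: eqs v_def[symmetric] s2_def)
    qed
    then show ?thesis
      unfolding propose_def using full
      by (simp add: r_def[symmetric] k_def[symmetric] hv k'_def[symmetric] s1_def[symmetric] s1_simps)
  qed
qed

lemma wp_proposals:
  assumes s: "auction_ok s" "H \<le> s ''i'' 0"
  shows "wp proposals (\<lambda>t s'. proposal_inv (assignment s') (s' ''next'') \<and>
    finished (assignment s') (s' ''next'') \<and>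
    t \<le> 2 + (R * instance_size I * Suc R + R) * (11 + 5 * instance_size I)) s"
proof -
  let ?s = "s(''i'' := (s ''i'')(0 := 0))"
  have inv: "auction_inv (assignment s) (s ''price'')" and cnt: "counts_ok s"
    and lower: "\<And>h. h < H \<Longrightarrow> lquota I h \<le> s ''cnt'' h" and nxt: "s ''next'' = (\<lambda>_. 0)"
    using s by (auto simp: auction_ok_def)
  have "proposal_inv (assignment s) (\<lambda>_. 0)"
  proof (rule proposal_inv_init)
    fix h assume "h \<in> hospitals I"
    then show "card (occupants (assignment s) h) = lquota I h"
      using inv cnt lower by (auto simp: auction_inv_def counts_ok_def hospitals_eq intro: antisym)
  qed (use inv in \<open>auto simp: auction_inv_def\<close>)
  then have init: "proposals_ok ?s"
    using s cnt nxt by (simp add: proposals_ok_def auction_ok_def counts_ok_def assignment_upd)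
  have "(\<Sum>r<R. length (rpref I r)) \<le> (\<Sum>r<R. instance_size I)"
    using length_rpref_le by (intro sum_mono) simp
  then have meas: "proposals_measure ?s \<le> R * instance_size I * Suc R + R"
    using nxt unfolding proposals_measure_def by (intro add_mono mult_le_mono1) simp_all
  show ?thesis
    unfolding proposals_def wp_Seq[of "assign ''i'' (Const 0)"] wp_Store
  proof (rule wp_mono[OF wp_While[where Inv = proposals_ok and f = proposals_measure and K = "10 + 5 * instance_size I"]])
    show "proposals_ok (s(''i'' := (s ''i'')(aval (Const 0) s := aval (Const 0) s)))" using init by simp
  next
    fix s assume ok: "proposals_ok s" and b: "bval (Less (var ''i'') (Read ''count'' (Const 0))) s"
    then have i: "s ''i'' 0 < R" and deg: "s ''rdegree'' (s ''i'' 0) = length (rpref I (s ''i'' 0))"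
      by (auto simp: proposals_ok_def holds_instance_def)
    show "wp (Cond (Conj (Equal (Read ''match'' (var ''i'')) (Const 0))
               (Less (Read ''next'' (var ''i'')) (Read ''rdegree'' (var ''i''))))
         propose (increment ''i'' (Const 0)))
       (\<lambda>t s'. proposals_ok s' \<and> proposals_measure s' < proposals_measure s \<and> t \<le> 10 + 5 * instance_size I) s"
      (is "wp (Cond _ ?c _) ?Q s")
    proof (cases "s ''match'' (s ''i'' 0) = 0 \<and> s ''next'' (s ''i'' 0) < length (rpref I (s ''i'' 0))")
      case True
      have "wp ?c (\<lambda>t. ?Q (Suc t)) s"
        by (rule wp_mono[OF proposal_round[OF ok i]]) (use True in simp_all)
      then show ?thesis
        using True by (simp only: wp_Cond bval.simps aval.simps deg if_True simp_thms)
    next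
      case False
      then show ?thesis using ok i deg
        by (auto simp: proposals_ok_def proposals_measure_def counts_ok_def assignment_upd less_Suc_eq)
    qed
  next
    fix t s'
    assume asm: "proposals_ok s' \<and> \<not> bval (Less (var ''i'') (Read ''count'' (Const 0))) s' \<and>
      t \<le> Suc (proposals_measure (s(''i'' := (s ''i'')(aval (Const 0) s := aval (Const 0) s))) *
        Suc (10 + 5 * instance_size I))"
    then have "R \<le> s' ''i'' 0" and ok: "proposals_ok s'"
      by (auto simp: proposals_ok_def holds_instance_def)
    then have "finished (assignment s') (s' ''next'')"
      by (auto simp: finished_def proposals_ok_def residents_eq assignment_def)
    moreover have "t \<le> Suc ((R * instance_size I * Suc R + R) * Suc (10 + 5 * instance_size I))"
      using asm mult_le_mono1[OF meas, of "Suc (10 + 5 * instance_size I)"]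
      by (simp only: aval.simps) linarith
    ultimately show "proposal_inv (assignment s') (s' ''next'') \<and>
      finished (assignment s') (s' ''next'') \<and>
      1 + t \<le> 2 + (R * instance_size I * Suc R + R) * (11 + 5 * instance_size I)"
      using ok by (simp add: proposals_ok_def)
  qed
qed

lemma wp_solver:
  assumes feas: "feasible_matching I N"
  shows "wp solver (\<lambda>t s. t \<le> 100 * Suc (instance_size I) ^ 4 \<and>
    proposal_inv (assignment s) (s ''next'') \<and> finished (assignment s) (s ''next'')) (input_memory I)"
proof -
  let ?n = "instance_size I"
  define s where "s = input_memory I"
  have s_count: "s ''count'' 0 = R" "s ''count'' (Suc 0) = H"
    by (simp_all add: s_def input_memory_def Let_def array_of_list_def R_def H_def)
  have s_rest: "s ''roff'' = (\<lambda>_. 0)" "s ''hoff'' = (\<lambda>_. 0)" "s ''next'' = (\<lambda>_. 0)"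
    "s ''match'' = (\<lambda>_. 0)" "s ''cnt'' = (\<lambda>_. 0)" "s ''price'' = (\<lambda>_. 0)"
    by (simp_all add: s_def input_memory_def Let_def)
  have s_res: "s ''rdegree'' r = length (rpref I r)" if "r < R" for r
    using that by (simp add: s_def input_memory_def Let_def array_of_list_def R_def)
  have s_hosp: "s ''lquota'' h = lquota I h" "s ''uquota'' h = uquota I h"
    "s ''hdegree'' h = length (hpref I h)" if "h < H" for h
    using that by (simp_all add: s_def input_memory_def Let_def array_of_list_def H_def)
  have s_rpref: "s ''rpref'' = array_of_list (concat (map (rpref I) [0..<R]))"
    by (simp add: s_def input_memory_def Let_def R_def)
  have s_hpref: "s ''hpref'' = array_of_list (concat (map (hpref I) [0..<H]))"
    by (simp add: s_def input_memory_def Let_def H_def)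
  let ?Q = "\<lambda>t s. t \<le> 100 * Suc ?n ^ 4 \<and>
    proposal_inv (assignment s) (s ''next'') \<and> finished (assignment s) (s ''next'')"
  show ?thesis
    unfolding solver_def wp_Seq s_def[symmetric]
  proof (rule wp_mono[OF wp_offsets[where N = R]])
    fix t1 s1
    assume 1: "t1 \<le> 2 + 3 * R \<and> (\<forall>x. x \<noteq> ''i'' \<longrightarrow> x \<noteq> ''roff'' \<longrightarrow> s1 x = s x) \<and>
      (\<forall>i\<le>R. s1 ''roff'' i = (\<Sum>j<i. s ''rdegree'' j))"
    show "wp (offsets 1 ''hdegree'' ''hoff'')
      (\<lambda>t. wp auction (\<lambda>u. wp proposals (\<lambda>v. ?Q (t1 + (t + (u + v)))))) s1"
    proof (rule wp_mono[OF wp_offsets[where N = H]])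
      fix t2 s2
      assume 2: "t2 \<le> 2 + 3 * H \<and> (\<forall>x. x \<noteq> ''i'' \<longrightarrow> x \<noteq> ''hoff'' \<longrightarrow> s2 x = s1 x) \<and>
        (\<forall>i\<le>H. s2 ''hoff'' i = (\<Sum>j<i. s1 ''hdegree'' j))"
      have same: "s2 x = s x" if "x \<noteq> ''i''" "x \<noteq> ''roff''" "x \<noteq> ''hoff''" for x
        using that 1 2 by simp
      have roff: "s2 ''roff'' r = (\<Sum>j<r. length (rpref I j))" if "r < R" for r
      proof -
        have "s2 ''roff'' r = (\<Sum>j<r. s ''rdegree'' j)" using 1 2 that by simp
        then show ?thesis using that s_res by simp
      qed
      have hoff: "s2 ''hoff'' h = (\<Sum>j<h. length (hpref I j))" if "h < H" for h
      proof -
        have "s2 ''hoff'' h = (\<Sum>j<h. s ''hdegree'' j)" using 1 2 that by simp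
        then show ?thesis using that s_hosp by simp
      qed
      have hold: "holds_instance s2"
        unfolding holds_instance_def
        using roff hoff s_res s_hosp s_count
          array_of_concat[of _ R _ "rpref I"] array_of_concat[of _ H _ "hpref I"]
        by (simp add: same s_rpref s_hpref)
      show "wp auction (\<lambda>u. wp proposals (\<lambda>v. ?Q (t1 + (t2 + (u + v))))) s2"
      proof (rule wp_mono[OF wp_auction[OF feas hold]])
        fix t3 s3
        assume 3: "auction_ok s3 \<and> H \<le> s3 ''i'' 0 \<and> t3 \<le> 2 + (R * Suc R * Suc H + H) * (11 + 5 * ?n)"
        show "wp proposals (\<lambda>v. ?Q (t1 + (t2 + (t3 + v)))) s3"
        proof (rule wp_mono[OF wp_proposals])
          fix t4 s4
          assume 4: "proposal_inv (assignment s4) (s4 ''next'') \<and> finished (assignment s4) (s4 ''next'') \<and>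
            t4 \<le> 2 + (R * ?n * Suc R + R) * (11 + 5 * ?n)"
          define n where "n = Suc ?n"
          have le: "R \<le> n" "H \<le> n" "Suc R \<le> n" "Suc H \<le> n" "?n \<le> n" "1 \<le> n" "11 + 5 * ?n \<le> 11 * n"
            using R_le H_le by (simp_all add: n_def)
          have pow: "n \<le> n ^ 4" "1 \<le> n ^ 4" "n ^ 3 * n = n ^ 4" "n \<le> n ^ 3"
            using le(6) self_le_power[of n 4] self_le_power[of n 3]
            by (simp_all add: power_Suc2[symmetric] del: power_Suc)
          have "R * Suc R * Suc H + H \<le> n * n * n + n" "R * ?n * Suc R + R \<le> n * n * n + n"
            by (intro add_mono mult_le_mono le)+
          moreover have "n * n * n = n ^ 3" by (simp add: power3_eq_cube)
          ultimately have cube: "R * Suc R * Suc H + H \<le> 2 * n ^ 3" "R * ?n * Suc R + R \<le> 2 * n ^ 3"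
            using pow(4) by linarith+
          have "(R * Suc R * Suc H + H) * (11 + 5 * ?n) \<le> 2 * n ^ 3 * (11 * n)"
            "(R * ?n * Suc R + R) * (11 + 5 * ?n) \<le> 2 * n ^ 3 * (11 * n)"
            by (intro mult_le_mono cube le)+
          then have "t3 \<le> 2 + 22 * n ^ 4" "t4 \<le> 2 + 22 * n ^ 4"
            using 3 4 pow(3) by (simp_all add: mult.assoc)
          moreover have "t1 \<le> 2 + 3 * n" "t2 \<le> 2 + 3 * n" using 1 2 le by linarith+
          ultimately have "t1 + (t2 + (t3 + t4)) \<le> 100 * n ^ 4" using pow by linarith
          then show "?Q (t1 + (t2 + (t3 + t4))) s4" using 4 by (simp add: n_def)
        qed (use 3 in auto)
      qed (use same s_rest in simp_all)
    qed (use 1 s_count s_rest in simp_all)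
  qed (use s_count s_rest in simp_all)
qed

end

lemma solver_correct:
  "polynomial_time_computes solver (\<lambda>I. \<exists>M. feasible_matching I M)
     (\<lambda>I M. feasible_matching I M \<and> relaxed_stable I M \<and>
        real (card M) \<ge> 2 / 3 * real (max_feasible_relaxed_stable_size I))"
  unfolding polynomial_time_computes_def
proof (intro exI[of _ "[:100:] * [:1, 1:] ^ 4"] allI impI, elim conjE exE)
  fix I :: "(nat, nat) hrlq" and N
  assume "numbered_instance I" and feas: "feasible_matching I N"
  then interpret numbered_hrlq I by unfold_locales
  obtain t s where run: "runs solver (input_memory I) t s" "t \<le> 100 * Suc (instance_size I) ^ 4"
    and inv: "proposal_inv (assignment s) (s ''next'')" and fin: "finished (assignment s) (s ''next'')"
    using wp_solver[OF feas] by (auto simp: wp_def)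
  have "t \<le> poly ([:100:] * [:1, 1:] ^ 4) (instance_size I)" using run(2) by simp
  then show "\<exists>t s. runs solver (input_memory I) t s \<and> t \<le> poly ([:100:] * [:1, 1:] ^ 4) (instance_size I) \<and>
      feasible_matching I (output_matching I s) \<and> relaxed_stable I (output_matching I s) \<and>
      2 / 3 * real (max_feasible_relaxed_stable_size I) \<le> real (card (output_matching I s))"
    using run(1) feasible_graph[OF inv] relaxed_stable_graph[OF inv fin] approximation_graph[OF inv fin]
    unfolding output_matching_eq by blast
qed

theorem theorem6:
  shows "(\<forall>I :: ('r, 'h) hrlq.
            hrlq_instance I \<and> (\<exists>M. feasible_matching I M) \<longrightarrow>
            (\<exists>M. feasible_matching I M \<and> relaxed_stable I M)) \<and>
         (\<exists>c. polynomial_time_computes c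
            (\<lambda>I. \<exists>M. feasible_matching I M)
            (\<lambda>I M. feasible_matching I M \<and> relaxed_stable I M \<and>
               real (card M) \<ge> 2 / 3 * real (max_feasible_relaxed_stable_size I)))"
  using hrlq.relaxed_stable_exists[OF hrlq.intro] solver_correct by blast

end
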